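(* Let $\mathsf{A}$ be an abelian category, $\mathsf{V}$ a special preenveloping subcategory of $\mathsf{A}$ and $\mathsf{W}$ a special precovering subcategory of $\mathsf{A}$. For objects $M$ and $N$ in $\mathsf{A}$ there are two equalities $$\overline{\operatorname{Hom}}{}^{\mathsf{V}}_{\mathsf{A}}(M,N)=\operatorname{Hom}_{\mathsf{A}}(M,N)/\mathsf{V}\!\operatorname{Hom}_{\mathsf{A}}(M,N)$$ and $$\underline{\operatorname{Hom}}{}^{\mathsf{W}}_{\mathsf{A}}(M,N)=\operatorname{Hom}_{\mathsf{A}}(M,N)/\mathsf{W}\!\operatorname{Hom}_{\mathsf{A}}(M,N),$$ where $\mathsf{V}\!\operatorname{Hom}_{\mathsf{A}}(M,N)$ (resp. $\mathsf{W}\!\operatorname{Hom}_{\mathsf{A}}(M,N)$) is the subgroup of $\operatorname{Hom}_{\mathsf{A}}(M,N)$ consisting of the morphisms that factor through an object in $\mathsf{V}$ (resp. $\mathsf{W}$).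
   Context: "Subcategory" means a full additive subcategory closed under isomorphisms; Ext is Yoneda Ext. ${}^{\perp}\mathsf{V}=\{M\mid\operatorname{Ext}^1_{\mathsf{A}}(M,V)=0\ \forall V\in\mathsf{V}\}$, $\mathsf{W}^{\perp}=\{N\mid\operatorname{Ext}^1_{\mathsf{A}}(W,N)=0\ \forall W\in\mathsf{W}\}$. $\mathsf{V}$ is special preenveloping if every object $M$ admits an exact sequence $0\to M\to V\to C\to0$ with $V\in\mathsf{V}$, $C\in{}^{\perp}\mathsf{V}$; $\mathsf{W}$ is special precovering if every object $M$ admits an exact sequence $0\to K\to W\to M\to0$ with $W\in\mathsf{W}$, $K\in\mathsf{W}^{\perp}$. A proper $\mathsf{V}$-coresolution of $M$ is a complex $0\to I^0\to I^1\to\cdots$ of objects in $\mathsf{V}$ together with an exact sequence $0\to M\xrightarrow{d}I^0\to I^1\to\cdots$ which stays exact under $\operatorname{Hom}_{\mathsf{A}}(-,V)$ for all $V\in\mathsf{V}$. A proper $\mathsf{W}$-resolution of $N$ is, dually, given by an exact sequence $\cdots\to P_1\to P_0\xrightarrow{f}N\to0$ with $P_i\in\mathsf{W}$ which stays exact under $\operatorname{Hom}_{\mathsf{A}}(W,-)$ for all $W\in\mathsf{W}$. For a contravariant additive functor $\mathrm{F}\colon\mathsf{A}\to\mathsf{Ab}$ put $\mathrm{L}_0^{\mathsf{V}}\mathrm{F}(M)=\operatorname{Coker}(\mathrm{F}(I^1)\to\mathrm{F}(I^0))$; $\mathrm{F}(d)$ induces a natural transformation $\rho\colon\mathrm{L}_0^{\mathsf{V}}\mathrm{F}\to\mathrm{F}$,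 and the $\mathsf{V}$-stable functor is $\overline{\mathrm{F}}^{\mathsf{V}}=\operatorname{Coker}\rho$. For a covariant additive functor $\mathrm{G}\colon\mathsf{A}\to\mathsf{Ab}$ put $\mathrm{L}_0^{\mathsf{W}}\mathrm{G}(N)=\operatorname{Coker}(\mathrm{G}(P_1)\to\mathrm{G}(P_0))$; $\mathrm{G}(f)$ induces $\varrho\colon\mathrm{L}_0^{\mathsf{W}}\mathrm{G}\to\mathrm{G}$, and the $\mathsf{W}$-stable functor is $\underline{\mathrm{G}}^{\mathsf{W}}=\operatorname{Coker}\varrho$. These are independent of the choice of (co)resolutions. $\overline{\operatorname{Hom}}{}^{\mathsf{V}}_{\mathsf{A}}(M,N)$ denotes $\overline{\mathrm{F}}^{\mathsf{V}}(M)$ for $\mathrm{F}=\operatorname{Hom}_{\mathsf{A}}(-,N)$, and $\underline{\operatorname{Hom}}{}^{\mathsf{W}}_{\mathsf{A}}(M,N)$ denotes $\underline{\mathrm{G}}^{\mathsf{W}}(N)$ for $\mathrm{G}=\operatorname{Hom}_{\mathsf{A}}(M,-)$. *)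

theory Defs
  imports "HOL-Algebra.Coset"
begin

section \<open>Abelian categories\<close>

text \<open>
  Composition \<open>g \<cdot> f\<close> means \<open>f\<close> first, then \<open>g\<close>.  \<open>Add\<close> is the addition on each
  Hom-set and \<open>Zero X Y\<close> the zero morphism from \<open>X\<close> to \<open>Y\<close>.  All operations are only
  constrained on \<open>Ob\<close>, \<open>Mor\<close> and composable, respectively parallel, morphisms.
\<close>

record ('o, 'm) add_category =
  Ob :: "'o set"
  Mor :: "'m set"
  Dom :: "'m \<Rightarrow> 'o"
  Cod :: "'m \<Rightarrow> 'o"
  Ident :: "'o \<Rightarrow> 'm"
  Comp :: "'m \<Rightarrow> 'm \<Rightarrow> 'm"  (infixl "\<cdot>\<index>" 75)
  Add :: "'m \<Rightarrow> 'm \<Rightarrow> 'm"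
  Zero :: "'o \<Rightarrow> 'o \<Rightarrow> 'm"

definition Hom :: "('o, 'm) add_category \<Rightarrow> 'o \<Rightarrow> 'o \<Rightarrow> 'm set" where
  "Hom A X Y = {f \<in> Mor A. Dom A f = X \<and> Cod A f = Y}"

text \<open>The Hom-group; as usual in HOL-Algebra, \<open>monoid\<close> records are written multiplicatively.\<close>

definition HomGrp :: "('o, 'm) add_category \<Rightarrow> 'o \<Rightarrow> 'o \<Rightarrow> 'm monoid" where
  "HomGrp A X Y = \<lparr>carrier = Hom A X Y, mult = Add A, one = Zero A X Y\<rparr>"

locale category =
  fixes A :: "('o, 'm) add_category" (structure)
  assumes Dom_Ob: "f \<in> Mor A \<Longrightarrow> Dom A f \<in> Ob A"
    and Cod_Ob: "f \<in> Mor A \<Longrightarrow> Cod A f \<in> Ob A"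
    and Ident_Hom: "X \<in> Ob A \<Longrightarrow> Ident A X \<in> Hom A X X"
    and Comp_Hom: "\<lbrakk>f \<in> Hom A X Y; g \<in> Hom A Y Z\<rbrakk> \<Longrightarrow> g \<cdot> f \<in> Hom A X Z"
    and Comp_assoc:
      "\<lbrakk>f \<in> Hom A X Y; g \<in> Hom A Y Z; h \<in> Hom A Z T\<rbrakk> \<Longrightarrow> h \<cdot> (g \<cdot> f) = (h \<cdot> g) \<cdot> f"
    and Comp_Ident: "f \<in> Hom A X Y \<Longrightarrow> f \<cdot> Ident A X = f"
    and Ident_Comp: "f \<in> Hom A X Y \<Longrightarrow> Ident A Y \<cdot> f = f"

locale preadditive_category = category +
  assumes comm_group_Hom: "\<lbrakk>X \<in> Ob A; Y \<in> Ob A\<rbrakk> \<Longrightarrow> comm_group (HomGrp A X Y)"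
    and Comp_Add:
      "\<lbrakk>f \<in> Hom A X Y; f' \<in> Hom A X Y; g \<in> Hom A Y Z\<rbrakk>
        \<Longrightarrow> g \<cdot> Add A f f' = Add A (g \<cdot> f) (g \<cdot> f')"
    and Add_Comp:
      "\<lbrakk>f \<in> Hom A X Y; g \<in> Hom A Y Z; g' \<in> Hom A Y Z\<rbrakk>
        \<Longrightarrow> Add A g g' \<cdot> f = Add A (g \<cdot> f) (g' \<cdot> f)"

definition is_zero_object :: "('o, 'm) add_category \<Rightarrow> 'o \<Rightarrow> bool" where
  "is_zero_object A Z \<longleftrightarrow> Z \<in> Ob A \<and>
    (\<forall>X \<in> Ob A. (\<exists>!f. f \<in> Hom A X Z) \<and> (\<exists>!f. f \<in> Hom A Z X))"

definition is_biproduct ::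
    "('o, 'm) add_category \<Rightarrow> 'o \<Rightarrow> 'o \<Rightarrow> 'o \<Rightarrow> 'm \<Rightarrow> 'm \<Rightarrow> 'm \<Rightarrow> 'm \<Rightarrow> bool" where
  "is_biproduct A X Y P i j p q \<longleftrightarrow>
    X \<in> Ob A \<and> Y \<in> Ob A \<and> P \<in> Ob A \<and>
    i \<in> Hom A X P \<and> j \<in> Hom A Y P \<and> p \<in> Hom A P X \<and> q \<in> Hom A P Y \<and>
    p \<cdot>\<^bsub>A\<^esub> i = Ident A X \<and> q \<cdot>\<^bsub>A\<^esub> j = Ident A Y \<and>
    q \<cdot>\<^bsub>A\<^esub> i = Zero A X Y \<and> p \<cdot>\<^bsub>A\<^esub> j = Zero A Y X \<and>
    Add A (i \<cdot>\<^bsub>A\<^esub> p) (j \<cdot>\<^bsub>A\<^esub> q) = Ident A P"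

definition is_mono :: "('o, 'm) add_category \<Rightarrow> 'm \<Rightarrow> bool" where
  "is_mono A f \<longleftrightarrow> f \<in> Mor A \<and>
    (\<forall>X. \<forall>g \<in> Hom A X (Dom A f). \<forall>h \<in> Hom A X (Dom A f). f \<cdot>\<^bsub>A\<^esub> g = f \<cdot>\<^bsub>A\<^esub> h \<longrightarrow> g = h)"

definition is_epi :: "('o, 'm) add_category \<Rightarrow> 'm \<Rightarrow> bool" where
  "is_epi A f \<longleftrightarrow> f \<in> Mor A \<and>
    (\<forall>Y. \<forall>g \<in> Hom A (Cod A f) Y. \<forall>h \<in> Hom A (Cod A f) Y. g \<cdot>\<^bsub>A\<^esub> f = h \<cdot>\<^bsub>A\<^esub> f \<longrightarrow> g = h)"

definition is_kernel :: "('o, 'm) add_category \<Rightarrow> 'm \<Rightarrow> 'm \<Rightarrow> bool" where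
  "is_kernel A k f \<longleftrightarrow> f \<in> Mor A \<and> k \<in> Mor A \<and> Cod A k = Dom A f \<and>
    f \<cdot>\<^bsub>A\<^esub> k = Zero A (Dom A k) (Cod A f) \<and>
    (\<forall>X. \<forall>h \<in> Hom A X (Dom A f). f \<cdot>\<^bsub>A\<^esub> h = Zero A X (Cod A f)
      \<longrightarrow> (\<exists>!u. u \<in> Hom A X (Dom A k) \<and> k \<cdot>\<^bsub>A\<^esub> u = h))"

definition is_cokernel :: "('o, 'm) add_category \<Rightarrow> 'm \<Rightarrow> 'm \<Rightarrow> bool" where
  "is_cokernel A c f \<longleftrightarrow> f \<in> Mor A \<and> c \<in> Mor A \<and> Dom A c = Cod A f \<and>
    c \<cdot>\<^bsub>A\<^esub> f = Zero A (Dom A f) (Cod A c) \<and>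
    (\<forall>Y. \<forall>h \<in> Hom A (Cod A f) Y. h \<cdot>\<^bsub>A\<^esub> f = Zero A (Dom A f) Y
      \<longrightarrow> (\<exists>!u. u \<in> Hom A (Cod A c) Y \<and> u \<cdot>\<^bsub>A\<^esub> c = h))"

locale abelian_category = preadditive_category +
  assumes ex_zero_object: "\<exists>Z. is_zero_object A Z"
    and ex_biproduct:
      "\<lbrakk>X \<in> Ob A; Y \<in> Ob A\<rbrakk> \<Longrightarrow> \<exists>P i j p q. is_biproduct A X Y P i j p q"
    and ex_kernel: "f \<in> Mor A \<Longrightarrow> \<exists>k. is_kernel A k f"
    and ex_cokernel: "f \<in> Mor A \<Longrightarrow> \<exists>c. is_cokernel A c f"
    and mono_is_kernel: "is_mono A f \<Longrightarrow> \<exists>g. is_kernel A f g"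
    and epi_is_cokernel: "is_epi A f \<Longrightarrow> \<exists>g. is_cokernel A f g"


section \<open>Exactness and Yoneda Ext\<close>

text \<open>
  Exactness of \<open>X \<rightarrow> Y \<rightarrow> Z\<close> at \<open>Y\<close>: the image of \<open>f\<close>, i.e. the kernel \<open>k\<close> of its cokernel
  \<open>c\<close>, is the kernel of \<open>g\<close> (this forces \<open>g \<cdot> f\<close> to be zero).
\<close>

definition exact :: "('o, 'm) add_category \<Rightarrow> 'm \<Rightarrow> 'm \<Rightarrow> bool" where
  "exact A f g \<longleftrightarrow> f \<in> Mor A \<and> g \<in> Mor A \<and> Cod A f = Dom A g \<and>
    (\<exists>c k. is_cokernel A c f \<and> is_kernel A k c \<and> is_kernel A k g)"

text \<open>Exactness of \<open>0 \<rightarrow> X \<rightarrow> Y\<close> at \<open>X\<close> and of \<open>X \<rightarrow> Y \<rightarrow> 0\<close> at \<open>Y\<close>.\<close>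

definition exact_from_zero :: "('o, 'm) add_category \<Rightarrow> 'm \<Rightarrow> bool" where
  "exact_from_zero A f \<longleftrightarrow> (\<exists>Z. is_zero_object A Z \<and> exact A (Zero A Z (Dom A f)) f)"

definition exact_to_zero :: "('o, 'm) add_category \<Rightarrow> 'm \<Rightarrow> bool" where
  "exact_to_zero A f \<longleftrightarrow> (\<exists>Z. is_zero_object A Z \<and> exact A f (Zero A (Cod A f) Z))"

definition short_exact :: "('o, 'm) add_category \<Rightarrow> 'm \<Rightarrow> 'm \<Rightarrow> bool" where
  "short_exact A i p \<longleftrightarrow> exact_from_zero A i \<and> exact A i p \<and> exact_to_zero A p"

text \<open>Extensions \<open>0 \<rightarrow> N \<rightarrow> E \<rightarrow> M \<rightarrow> 0\<close> of \<open>M\<close> by \<open>N\<close>, and their equivalence.\<close>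

definition extensions :: "('o, 'm) add_category \<Rightarrow> 'o \<Rightarrow> 'o \<Rightarrow> ('m \<times> 'm) set" where
  "extensions A M N =
    {(i, p). \<exists>E. i \<in> Hom A N E \<and> p \<in> Hom A E M \<and> short_exact A i p}"

definition is_iso :: "('o, 'm) add_category \<Rightarrow> 'm \<Rightarrow> bool" where
  "is_iso A f \<longleftrightarrow> f \<in> Mor A \<and>
    (\<exists>g \<in> Hom A (Cod A f) (Dom A f).
      g \<cdot>\<^bsub>A\<^esub> f = Ident A (Dom A f) \<and> f \<cdot>\<^bsub>A\<^esub> g = Ident A (Cod A f))"

definition ext_equiv :: "('o, 'm) add_category \<Rightarrow> 'o \<Rightarrow> 'o \<Rightarrow> (('m \<times> 'm) \<times> ('m \<times> 'm)) set" where
  "ext_equiv A M N =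
    {((i, p), (i', p')). (i, p) \<in> extensions A M N \<and> (i', p') \<in> extensions A M N \<and>
      (\<exists>u \<in> Hom A (Cod A i) (Cod A i'). is_iso A u \<and> u \<cdot>\<^bsub>A\<^esub> i = i' \<and> p' \<cdot>\<^bsub>A\<^esub> u = p)}"

definition Ext1 :: "('o, 'm) add_category \<Rightarrow> 'o \<Rightarrow> 'o \<Rightarrow> ('m \<times> 'm) set set" where
  "Ext1 A M N = extensions A M N // ext_equiv A M N"

text \<open>
  The neutral element for the Baer sum: the class of the extension
  \<open>0 \<rightarrow> N \<rightarrow> N \<oplus> M \<rightarrow> M \<rightarrow> 0\<close>, which consists of all direct sum extensions since direct sums
  are determined only up to isomorphism.  The Baer sum itself is not needed to say that
  the group \<open>Ext1 A M N\<close> is zero.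
\<close>

definition Ext1_zero :: "('o, 'm) add_category \<Rightarrow> 'o \<Rightarrow> 'o \<Rightarrow> ('m \<times> 'm) set" where
  "Ext1_zero A M N = {(i, p). \<exists>E r s. is_biproduct A N M E i s r p}"

definition Ext1_vanishes :: "('o, 'm) add_category \<Rightarrow> 'o \<Rightarrow> 'o \<Rightarrow> bool" where
  "Ext1_vanishes A M N \<longleftrightarrow> Ext1 A M N = {Ext1_zero A M N}"

definition left_perp :: "('o, 'm) add_category \<Rightarrow> 'o set \<Rightarrow> 'o set" where
  "left_perp A V = {M \<in> Ob A. \<forall>X \<in> V. Ext1_vanishes A M X}"

definition right_perp :: "('o, 'm) add_category \<Rightarrow> 'o set \<Rightarrow> 'o set" where
  "right_perp A W = {N \<in> Ob A. \<forall>X \<in> W. Ext1_vanishes A X N}"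


section \<open>Special preenveloping and special precovering subcategories\<close>

text \<open>
  A full subcategory is given by its set of objects.  It is additive, being preadditive already,
  iff it has a zero object and binary biproducts; both notions are equational, so they
  mean the same in a full subcategory as in the ambient category.
\<close>

definition subcategory :: "('o, 'm) add_category \<Rightarrow> 'o set \<Rightarrow> bool" where
  "subcategory A V \<longleftrightarrow> V \<subseteq> Ob A \<and>
    (\<exists>Z \<in> V. is_zero_object A Z) \<and>
    (\<forall>X \<in> V. \<forall>Y \<in> V. \<exists>P \<in> V. \<exists>i j p q. is_biproduct A X Y P i j p q) \<and>
    (\<forall>f. is_iso A f \<and> Dom A f \<in> V \<longrightarrow> Cod A f \<in> V)"

definition special_preenveloping :: "('o, 'm) add_category \<Rightarrow> 'o set \<Rightarrow> bool" where
  "special_preenveloping A V \<longleftrightarrow>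
    (\<forall>M \<in> Ob A. \<exists>X \<in> V. \<exists>C \<in> left_perp A V.
      \<exists>i \<in> Hom A M X. \<exists>p \<in> Hom A X C. short_exact A i p)"

definition special_precovering :: "('o, 'm) add_category \<Rightarrow> 'o set \<Rightarrow> bool" where
  "special_precovering A W \<longleftrightarrow>
    (\<forall>M \<in> Ob A. \<exists>X \<in> W. \<exists>K \<in> right_perp A W.
      \<exists>i \<in> Hom A K X. \<exists>p \<in> Hom A X M. short_exact A i p)"


section \<open>Functors to abelian groups and their stable functors\<close>

text \<open>
  The data of a functor to abelian groups.  \<open>Fmor F f\<close> is a homomorphism
  \<open>Fob F (Dom f) \<rightarrow> Fob F (Cod f)\<close> for covariant \<open>F\<close>, and
  \<open>Fob F (Cod f) \<rightarrow> Fob F (Dom f)\<close> for contravariant \<open>F\<close>.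
\<close>

record ('o, 'm, 'a) ab_functor =
  Fob :: "'o \<Rightarrow> 'a monoid"
  Fmor :: "'m \<Rightarrow> 'a \<Rightarrow> 'a"

text \<open>The contravariant functor \<open>Hom(-, N)\<close> and the covariant functor \<open>Hom(M, -)\<close>.\<close>

definition HomInto :: "('o, 'm) add_category \<Rightarrow> 'o \<Rightarrow> ('o, 'm, 'm) ab_functor" where
  "HomInto A N = \<lparr>Fob = (\<lambda>X. HomGrp A X N), Fmor = (\<lambda>g f. f \<cdot>\<^bsub>A\<^esub> g)\<rparr>"

definition HomFrom :: "('o, 'm) add_category \<Rightarrow> 'o \<Rightarrow> ('o, 'm, 'm) ab_functor" where
  "HomFrom A M = \<lparr>Fob = (\<lambda>X. HomGrp A M X), Fmor = (\<lambda>g f. g \<cdot>\<^bsub>A\<^esub> f)\<rparr>"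

definition Coker :: "'a monoid \<Rightarrow> 'b monoid \<Rightarrow> ('a \<Rightarrow> 'b) \<Rightarrow> 'b set monoid" where
  "Coker G H h = H Mod (h ` carrier G)"

text \<open>
  Proper (co)resolutions consist of the objects \<open>I n\<close> (resp. \<open>P n\<close>), the differentials
  \<open>\<delta> n : I n \<rightarrow> I (n + 1)\<close> (resp. \<open>\<delta> n : P (n + 1) \<rightarrow> P n\<close>) and the augmentation \<open>d : M \<rightarrow> I 0\<close>
  (resp. \<open>f : P 0 \<rightarrow> N\<close>).
\<close>

definition proper_coresolution ::
    "('o, 'm) add_category \<Rightarrow> 'o set \<Rightarrow> 'o \<Rightarrow> (nat \<Rightarrow> 'o) \<Rightarrow> (nat \<Rightarrow> 'm) \<Rightarrow> 'm \<Rightarrow> bool" where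
  "proper_coresolution A V M I \<delta> d \<longleftrightarrow>
    (\<forall>n. I n \<in> V) \<and> (\<forall>n. \<delta> n \<in> Hom A (I n) (I (Suc n))) \<and> d \<in> Hom A M (I 0) \<and>
    exact_from_zero A d \<and> exact A d (\<delta> 0) \<and> (\<forall>n. exact A (\<delta> n) (\<delta> (Suc n))) \<and>
    (\<forall>X \<in> V. let F = HomInto A X in
      Fmor F d ` carrier (Fob F (I 0)) = carrier (Fob F M) \<and>
      Fmor F (\<delta> 0) ` carrier (Fob F (I 1)) = kernel (Fob F (I 0)) (Fob F M) (Fmor F d) \<and>
      (\<forall>n. Fmor F (\<delta> (Suc n)) ` carrier (Fob F (I (Suc (Suc n))))
            = kernel (Fob F (I (Suc n))) (Fob F (I n)) (Fmor F (\<delta> n))))"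

definition proper_resolution ::
    "('o, 'm) add_category \<Rightarrow> 'o set \<Rightarrow> 'o \<Rightarrow> (nat \<Rightarrow> 'o) \<Rightarrow> (nat \<Rightarrow> 'm) \<Rightarrow> 'm \<Rightarrow> bool" where
  "proper_resolution A W N P \<delta> f \<longleftrightarrow>
    (\<forall>n. P n \<in> W) \<and> (\<forall>n. \<delta> n \<in> Hom A (P (Suc n)) (P n)) \<and> f \<in> Hom A (P 0) N \<and>
    exact_to_zero A f \<and> exact A (\<delta> 0) f \<and> (\<forall>n. exact A (\<delta> (Suc n)) (\<delta> n)) \<and>
    (\<forall>X \<in> W. let G = HomFrom A X in
      Fmor G f ` carrier (Fob G (P 0)) = carrier (Fob G N) \<and>
      Fmor G (\<delta> 0) ` carrier (Fob G (P 1)) = kernel (Fob G (P 0)) (Fob G N) (Fmor G f) \<and>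
      (\<forall>n. Fmor G (\<delta> (Suc n)) ` carrier (Fob G (P (Suc (Suc n))))
            = kernel (Fob G (P (Suc n))) (Fob G (P n)) (Fmor G (\<delta> n))))"

text \<open>
  The functors below are computed from a given (co)resolution, which is a parameter.  Elements of
  \<open>L0\<close> are cosets, and the map induced by \<open>F d\<close> sends a coset to the common value of
  \<open>F d\<close> on its elements.
\<close>

definition L0_V :: "('o, 'm, 'a) ab_functor \<Rightarrow> (nat \<Rightarrow> 'o) \<Rightarrow> (nat \<Rightarrow> 'm) \<Rightarrow> 'a set monoid" where
  "L0_V F I \<delta> = Coker (Fob F (I 1)) (Fob F (I 0)) (Fmor F (\<delta> 0))"

definition rho_V :: "('o, 'm, 'a) ab_functor \<Rightarrow> 'm \<Rightarrow> 'a set \<Rightarrow> 'a" where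
  "rho_V F d = (\<lambda>x. the_elem (Fmor F d ` x))"

definition stable_V ::
    "('o, 'm, 'a) ab_functor \<Rightarrow> (nat \<Rightarrow> 'o) \<Rightarrow> (nat \<Rightarrow> 'm) \<Rightarrow> 'm \<Rightarrow> 'o \<Rightarrow> 'a set monoid" where
  "stable_V F I \<delta> d M = Coker (L0_V F I \<delta>) (Fob F M) (rho_V F d)"

definition L0_W :: "('o, 'm, 'a) ab_functor \<Rightarrow> (nat \<Rightarrow> 'o) \<Rightarrow> (nat \<Rightarrow> 'm) \<Rightarrow> 'a set monoid" where
  "L0_W G P \<delta> = Coker (Fob G (P 1)) (Fob G (P 0)) (Fmor G (\<delta> 0))"

definition rho_W :: "('o, 'm, 'a) ab_functor \<Rightarrow> 'm \<Rightarrow> 'a set \<Rightarrow> 'a" where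
  "rho_W G f = (\<lambda>x. the_elem (Fmor G f ` x))"

definition stable_W ::
    "('o, 'm, 'a) ab_functor \<Rightarrow> (nat \<Rightarrow> 'o) \<Rightarrow> (nat \<Rightarrow> 'm) \<Rightarrow> 'm \<Rightarrow> 'o \<Rightarrow> 'a set monoid" where
  "stable_W G P \<delta> f N = Coker (L0_W G P \<delta>) (Fob G N) (rho_W G f)"

definition stable_Hom_V ::
    "('o, 'm) add_category \<Rightarrow> (nat \<Rightarrow> 'o) \<Rightarrow> (nat \<Rightarrow> 'm) \<Rightarrow> 'm \<Rightarrow> 'o \<Rightarrow> 'o \<Rightarrow> 'm set monoid" where
  "stable_Hom_V A I \<delta> d M N = stable_V (HomInto A N) I \<delta> d M"

definition stable_Hom_W ::
    "('o, 'm) add_category \<Rightarrow> (nat \<Rightarrow> 'o) \<Rightarrow> (nat \<Rightarrow> 'm) \<Rightarrow> 'm \<Rightarrow> 'o \<Rightarrow> 'o \<Rightarrow> 'm set monoid" where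
  "stable_Hom_W A P \<delta> f M N = stable_W (HomFrom A M) P \<delta> f N"

definition factor_Hom :: "('o, 'm) add_category \<Rightarrow> 'o set \<Rightarrow> 'o \<Rightarrow> 'o \<Rightarrow> 'm set" where
  "factor_Hom A V M N =
    {f \<in> Hom A M N. \<exists>X \<in> V. \<exists>g \<in> Hom A M X. \<exists>h \<in> Hom A X N. f = h \<cdot>\<^bsub>A\<^esub> g}"

end

theory Submission
  imports Defs
begin

text \<open>
  If \<open>0 \<rightarrow> M \<rightarrow> X \<rightarrow> C \<rightarrow> 0\<close> is a special preenvelope and \<open>Y \<in> V\<close>, then pushing it out along a
  morphism \<open>M \<rightarrow> Y\<close> gives an extension of \<open>C\<close> by \<open>Y\<close>, which splits; hence \<open>M \<rightarrow> Y\<close> extends to \<open>X\<close>.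
  Splicing special preenvelopes therefore gives a proper coresolution.  For any proper
  coresolution the image of \<open>\<rho>\<close> consists of the \<open>h \<cdot> d\<close> with \<open>h : I\<^sup>0 \<rightarrow> N\<close>; these are
  all the morphisms \<open>M \<rightarrow> N\<close> that factor through an object of \<open>V\<close>, because every morphism from
  \<open>M\<close> to such an object extends along \<open>d\<close>.  The statement on \<open>W\<close> is the statement on \<open>V\<close> in the
  opposite category.
\<close>

section \<open>Preadditive categories\<close>

lemma Hom_Mor: "f \<in> Hom A X Y \<Longrightarrow> f \<in> Mor A"
  and Hom_Dom: "f \<in> Hom A X Y \<Longrightarrow> Dom A f = X"
  and Hom_Cod: "f \<in> Hom A X Y \<Longrightarrow> Cod A f = Y"
  by (auto simp: Hom_def)

lemmas Hom_simps = Hom_Mor Hom_Dom Hom_Cod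

lemma (in category) Hom_Ob:
  assumes "f \<in> Hom A X Y"
  shows "X \<in> Ob A" "Y \<in> Ob A"
  using assms Dom_Ob Cod_Ob by (auto simp: Hom_def)

lemma (in category) is_mono_cancel:
  "\<lbrakk>is_mono A f; f \<in> Hom A X Y; g \<in> Hom A T X; h \<in> Hom A T X; f \<cdot> g = f \<cdot> h\<rbrakk> \<Longrightarrow> g = h"
  unfolding is_mono_def by (auto simp: Hom_simps)

lemma (in category) is_iso_Ident: "X \<in> Ob A \<Longrightarrow> is_iso A (Ident A X)"
  using Ident_Hom[of X] unfolding is_iso_def by (auto simp: Hom_simps Comp_Ident)

context preadditive_category
begin

lemma Zero_Hom: "\<lbrakk>X \<in> Ob A; Y \<in> Ob A\<rbrakk> \<Longrightarrow> Zero A X Y \<in> Hom A X Y"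
  using comm_group_Hom[THEN comm_group.axioms(2), THEN group.is_monoid, THEN monoid.one_closed, of X Y]
  by (simp add: HomGrp_def)

lemma Add_Hom: "\<lbrakk>f \<in> Hom A X Y; g \<in> Hom A X Y\<rbrakk> \<Longrightarrow> Add A f g \<in> Hom A X Y"
  using comm_group_Hom[THEN comm_group.axioms(2), THEN group.is_monoid, THEN monoid.m_closed, of X Y f g]
  by (simp add: HomGrp_def Hom_Ob)

lemma Add_comm: "\<lbrakk>f \<in> Hom A X Y; g \<in> Hom A X Y\<rbrakk> \<Longrightarrow> Add A f g = Add A g f"
  using comm_group_Hom[THEN comm_group.axioms(1), THEN comm_monoid.m_comm, of X Y f g]
  by (simp add: HomGrp_def Hom_Ob)

lemma Zero_Add: "f \<in> Hom A X Y \<Longrightarrow> Add A (Zero A X Y) f = f"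
  using comm_group_Hom[THEN comm_group.axioms(2), THEN group.is_monoid, THEN monoid.l_one, of X Y f]
  by (simp add: HomGrp_def Hom_Ob)

lemma Add_Zero: "f \<in> Hom A X Y \<Longrightarrow> Add A f (Zero A X Y) = f"
  using Zero_Add Add_comm Zero_Hom Hom_Ob by metis

lemma ex_negative:
  assumes "f \<in> Hom A X Y"
  obtains f' where "f' \<in> Hom A X Y" "Add A f f' = Zero A X Y" "Add A f' f = Zero A X Y"
proof -
  interpret G: comm_group "HomGrp A X Y"
    using assms comm_group_Hom Hom_Ob by blast
  show ?thesis
    using that[of "inv\<^bsub>HomGrp A X Y\<^esub> f"] G.inv_closed[of f] G.r_inv[of f] G.l_inv[of f] assms
    by (simp add: HomGrp_def)
qed

lemma Add_cancel_right:
  assumes "f \<in> Hom A X Y" "g \<in> Hom A X Y" "h \<in> Hom A X Y" "Add A f h = Add A g h"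
  shows "f = g"
proof -
  interpret G: comm_group "HomGrp A X Y"
    using assms comm_group_Hom Hom_Ob by blast
  show ?thesis
    using G.right_cancel[of h f g] assms by (simp add: HomGrp_def)
qed

text \<open>With z the composite, distributivity gives z + z = z, and cancelling z in the Hom-group
  leaves zero.\<close>

lemma Comp_Zero:
  assumes "g \<in> Hom A Y Z" "X \<in> Ob A"
  shows "g \<cdot> Zero A X Y = Zero A X Z"
proof (rule Add_cancel_right)
  have z: "Zero A X Y \<in> Hom A X Y"
    using assms Zero_Hom Hom_Ob by blast
  show gz: "g \<cdot> Zero A X Y \<in> Hom A X Z" "g \<cdot> Zero A X Y \<in> Hom A X Z"
    using z assms Comp_Hom by blast+
  show "Zero A X Z \<in> Hom A X Z"
    using assms Zero_Hom Hom_Ob by blast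
  show "Add A (g \<cdot> Zero A X Y) (g \<cdot> Zero A X Y) = Add A (Zero A X Z) (g \<cdot> Zero A X Y)"
    using Comp_Add[OF z z assms(1)] Zero_Add[OF z] Zero_Add[OF gz(1)] by simp
qed

lemma Zero_Comp:
  assumes "f \<in> Hom A X Y" "Z \<in> Ob A"
  shows "Zero A Y Z \<cdot> f = Zero A X Z"
proof (rule Add_cancel_right)
  have z: "Zero A Y Z \<in> Hom A Y Z"
    using assms Zero_Hom Hom_Ob by blast
  show zf: "Zero A Y Z \<cdot> f \<in> Hom A X Z" "Zero A Y Z \<cdot> f \<in> Hom A X Z"
    using z assms Comp_Hom by blast+
  show "Zero A X Z \<in> Hom A X Z"
    using assms Zero_Hom Hom_Ob by blast
  show "Add A (Zero A Y Z \<cdot> f) (Zero A Y Z \<cdot> f) = Add A (Zero A X Z) (Zero A Y Z \<cdot> f)"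
    using Add_Comp[OF assms(1) z z] Zero_Add[OF z] Zero_Add[OF zf(1)] by simp
qed

text \<open>Adding a negative of \<open>h\<close> turns \<open>f \<cdot> g = f \<cdot> h\<close>
  into the statement that \<open>f\<close> kills the difference of \<open>g\<close> and
  \<open>h\<close>, so additivity reduces cancellation to a trivial kernel.\<close>

lemma is_monoI:
  assumes f: "f \<in> Hom A X Y"
    and ker: "\<And>T t. \<lbrakk>t \<in> Hom A T X; f \<cdot> t = Zero A T Y\<rbrakk> \<Longrightarrow> t = Zero A T X"
  shows "is_mono A f"
  unfolding is_mono_def
proof (intro conjI allI ballI impI)
  show "f \<in> Mor A" using f by (rule Hom_Mor)
next
  fix T g h
  assume "g \<in> Hom A T (Dom A f)" "h \<in> Hom A T (Dom A f)" and eq: "f \<cdot> g = f \<cdot> h"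
  then have g: "g \<in> Hom A T X" and h: "h \<in> Hom A T X"
    using f by (auto simp: Hom_simps)
  obtain h' where h': "h' \<in> Hom A T X" "Add A h h' = Zero A T X"
    using ex_negative[OF h] by metis
  have "f \<cdot> Add A g h' = f \<cdot> Add A h h'"
    using Comp_Add[OF g h'(1) f] Comp_Add[OF h h'(1) f] eq by simp
  also have "\<dots> = Zero A T Y"
    using h' Comp_Zero f Hom_Ob g by simp
  finally have "Add A g h' = Add A h h'"
    using ker Add_Hom[OF g h'(1)] h' by simp
  then show "g = h"
    using Add_cancel_right[OF g h h'(1)] by simp
qed

lemma is_kernel_factor:
  assumes "is_kernel A k f" "k \<in> Hom A K X" "f \<in> Hom A X Y" "h \<in> Hom A T X" "f \<cdot> h = Zero A T Y"
  obtains u where "u \<in> Hom A T K" "k \<cdot> u = h"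
  using assms unfolding is_kernel_def by (metis Hom_Dom Hom_Cod)

lemma is_kernel_Hom:
  assumes "is_kernel A k f" "f \<in> Hom A X Y"
  obtains K where "k \<in> Hom A K X" "f \<cdot> k = Zero A K Y"
  using assms unfolding is_kernel_def by (auto simp: Hom_def)

lemma is_kernel_Comp:
  "\<lbrakk>is_kernel A k f; k \<in> Hom A K X; f \<in> Hom A X Y\<rbrakk> \<Longrightarrow> f \<cdot> k = Zero A K Y"
  unfolding is_kernel_def by (auto simp: Hom_def)

lemma is_kernelI:
  assumes "k \<in> Hom A K X" "f \<in> Hom A X Y" "f \<cdot> k = Zero A K Y" "is_mono A k"
    and "\<And>T h. \<lbrakk>h \<in> Hom A T X; f \<cdot> h = Zero A T Y\<rbrakk> \<Longrightarrow> \<exists>u \<in> Hom A T K. k \<cdot> u = h"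
  shows "is_kernel A k f"
proof -
  have "\<exists>!u. u \<in> Hom A T K \<and> k \<cdot> u = h" if "h \<in> Hom A T X" "f \<cdot> h = Zero A T Y" for T h
    using assms(5)[OF that] is_mono_cancel[OF assms(4,1)] by metis
  then show ?thesis
    using assms(1-3) unfolding is_kernel_def by (auto simp: Hom_simps)
qed

text \<open>\<open>g\<close> and \<open>h\<close> are factorisations through \<open>k\<close> of the
  same morphism, which \<open>f\<close> kills; uniqueness in the universal property identifies
  them.\<close>

lemma is_kernel_is_mono:
  assumes "is_kernel A k f"
  shows "is_mono A k"
proof -
  obtain X Y K where f: "f \<in> Hom A X Y" and k: "k \<in> Hom A K X" and fk: "f \<cdot> k = Zero A K Y"
    using assms unfolding is_kernel_def by (auto simp: Hom_def)
  have "g = h" if g: "g \<in> Hom A T K" and h: "h \<in> Hom A T K" and "k \<cdot> g = k \<cdot> h" for T g h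
  proof -
    have "f \<cdot> (k \<cdot> g) = Zero A K Y \<cdot> g"
      using Comp_assoc[OF g k f] fk by simp
    also have "\<dots> = Zero A T Y"
      using Zero_Comp[OF g] Hom_Ob f by simp
    finally show ?thesis
      using assms that Comp_Hom[OF g k] f k unfolding is_kernel_def
      by (metis Hom_Cod Hom_Dom)
  qed
  then show ?thesis
    using k unfolding is_mono_def by (auto simp: Hom_simps)
qed

end

section \<open>The opposite category\<close>

text \<open>\<open>Zero\<close> swaps its objects because the zero of \<open>Hom (opp A) X Y\<close>
  is that of \<open>Hom A Y X\<close>.\<close>

definition opp :: "('o, 'm) add_category \<Rightarrow> ('o, 'm) add_category" where
  "opp A = \<lparr>Ob = Ob A, Mor = Mor A, Dom = Cod A, Cod = Dom A, Ident = Ident A,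
    Comp = (\<lambda>g f. f \<cdot>\<^bsub>A\<^esub> g), Add = Add A, Zero = (\<lambda>X Y. Zero A Y X)\<rparr>"

lemma opp_sel:
  "Ob (opp A) = Ob A" "Mor (opp A) = Mor A" "Dom (opp A) = Cod A" "Cod (opp A) = Dom A"
  "Ident (opp A) = Ident A" "g \<cdot>\<^bsub>opp A\<^esub> f = f \<cdot>\<^bsub>A\<^esub> g" "Add (opp A) = Add A"
  "Zero (opp A) X Y = Zero A Y X"
  by (simp_all add: opp_def)

lemma opp_opp: "opp (opp A) = A"
  by (simp add: opp_def)

lemma Hom_opp: "Hom (opp A) X Y = Hom A Y X"
  by (auto simp: Hom_def opp_sel)

lemma HomGrp_opp: "HomGrp (opp A) X Y = HomGrp A Y X"
  by (simp add: HomGrp_def Hom_opp opp_sel)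

lemma is_zero_object_opp: "is_zero_object (opp A) Z \<longleftrightarrow> is_zero_object A Z"
  by (auto simp: is_zero_object_def Hom_opp opp_sel)

lemma is_mono_opp: "is_mono (opp A) f \<longleftrightarrow> is_epi A f"
  by (simp add: is_mono_def is_epi_def Hom_opp opp_sel)

lemma is_epi_opp: "is_epi (opp A) f \<longleftrightarrow> is_mono A f"
  by (simp add: is_mono_def is_epi_def Hom_opp opp_sel)

lemma is_kernel_opp: "is_kernel (opp A) k f \<longleftrightarrow> is_cokernel A k f"
  by (simp add: is_kernel_def is_cokernel_def Hom_opp opp_sel)

lemma is_cokernel_opp: "is_cokernel (opp A) c f \<longleftrightarrow> is_kernel A c f"
  by (simp add: is_kernel_def is_cokernel_def Hom_opp opp_sel)

lemma is_biproduct_opp: "is_biproduct (opp A) X Y P i j p q \<longleftrightarrow> is_biproduct A X Y P p q i j"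
  by (auto simp: is_biproduct_def Hom_opp opp_sel)

lemmas opp_simps = opp_sel Hom_opp HomGrp_opp is_zero_object_opp is_mono_opp is_epi_opp
  is_kernel_opp is_cokernel_opp is_biproduct_opp

lemma (in category) category_opp: "category (opp A)"
  by unfold_locales
    (simp_all add: opp_simps Dom_Ob Cod_Ob Ident_Hom Comp_Hom Comp_assoc Comp_Ident Ident_Comp)

lemma (in preadditive_category) preadditive_category_opp: "preadditive_category (opp A)"
  by (intro preadditive_category.intro preadditive_category_axioms.intro category_opp)
    (simp_all add: opp_simps comm_group_Hom Comp_Add Add_Comp)


lemma (in abelian_category) abelian_category_opp: "abelian_category (opp A)"
proof (intro abelian_category.intro preadditive_category_opp, unfold_locales)
  fix X Y assume "X \<in> Ob (opp A)" "Y \<in> Ob (opp A)"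
  then show "\<exists>P i j p q. is_biproduct (opp A) X Y P i j p q"
    using ex_biproduct[of X Y] unfolding opp_simps by blast
qed (auto simp: opp_simps ex_zero_object ex_kernel ex_cokernel mono_is_kernel epi_is_cokernel)

section \<open>Cokernels and epimorphisms by duality; kernels of composites\<close>

context preadditive_category
begin

text \<open>Each fact on cokernels and epimorphisms is the one on kernels and monomorphisms in
  \<open>opp A\<close>, translated back by \<open>opp_simps\<close>.\<close>

lemmas is_cokernel_factor =
  preadditive_category.is_kernel_factor[OF preadditive_category_opp, unfolded opp_simps]

lemmas is_cokernel_Hom =
  preadditive_category.is_kernel_Hom[OF preadditive_category_opp, unfolded opp_simps]

lemmas is_cokernel_Comp =
  preadditive_category.is_kernel_Comp[OF preadditive_category_opp, unfolded opp_simps]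

lemmas is_cokernelI =
  preadditive_category.is_kernelI[OF preadditive_category_opp, unfolded opp_simps]

lemmas is_cokernel_is_epi =
  preadditive_category.is_kernel_is_mono[OF preadditive_category_opp, unfolded opp_simps]

lemmas is_epi_cancel =
  category.is_mono_cancel[OF category_opp, unfolded opp_simps]

lemma is_mono_Comp_right:
  assumes "f \<in> Hom A X Y" "g \<in> Hom A Y Z" "is_mono A (g \<cdot> f)"
  shows "is_mono A f"
proof (rule is_monoI[OF assms(1)])
  fix T t assume t: "t \<in> Hom A T X" "f \<cdot> t = Zero A T Y"
  have X: "X \<in> Ob A" and T: "T \<in> Ob A"
    using assms(1) t Hom_Ob by blast+
  have gf: "g \<cdot> f \<in> Hom A X Z"
    using assms Comp_Hom by blast
  have "(g \<cdot> f) \<cdot> t = Zero A T Z"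
    using Comp_assoc[OF t(1) assms(1,2)] t(2) Comp_Zero[OF assms(2) T] by simp
  also have "\<dots> = (g \<cdot> f) \<cdot> Zero A T X"
    using Comp_Zero[OF gf T] by simp
  finally show "t = Zero A T X"
    using is_mono_cancel[OF assms(3) gf t(1) Zero_Hom[OF T X]] by blast
qed

lemmas is_epi_Comp_left =
  preadditive_category.is_mono_Comp_right[OF preadditive_category_opp, unfolded opp_simps]

lemma is_mono_Ident: "X \<in> Ob A \<Longrightarrow> is_mono A (Ident A X)"
  unfolding is_mono_def using Ident_Hom[of X] by (auto simp: Hom_simps Ident_Comp)

lemmas is_epi_Ident =
  preadditive_category.is_mono_Ident[OF preadditive_category_opp, unfolded opp_simps]

lemma is_mono_Zero_iff:
  assumes "f \<in> Hom A X Y" "is_mono A f" "t \<in> Hom A T X"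
  shows "f \<cdot> t = Zero A T Y \<longleftrightarrow> t = Zero A T X"
  using is_mono_cancel[OF assms(2,1,3)] Comp_Zero[OF assms(1)] Zero_Hom Hom_Ob assms by metis

text \<open>Since \<open>m\<close> is mono, \<open>m \<cdot> f\<close> and \<open>f\<close> kill the
  same morphisms.\<close>

lemma is_kernel_Comp_mono:
  assumes "is_kernel A k f" "f \<in> Hom A X Y" "m \<in> Hom A Y Z" "is_mono A m"
  shows "is_kernel A k (m \<cdot> f)"
proof -
  obtain K where k: "k \<in> Hom A K X" "f \<cdot> k = Zero A K Y"
    using is_kernel_Hom[OF assms(1,2)] .
  show ?thesis
  proof (rule is_kernelI)
    show "k \<in> Hom A K X" "m \<cdot> f \<in> Hom A X Z" "is_mono A k"
      using k assms Comp_Hom is_kernel_is_mono by blast+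
    show "(m \<cdot> f) \<cdot> k = Zero A K Z"
      using Comp_assoc[OF k(1) assms(2,3)] k Comp_Zero[OF assms(3)] Hom_Ob by metis
    fix T h assume h: "h \<in> Hom A T X" "(m \<cdot> f) \<cdot> h = Zero A T Z"
    have "f \<cdot> h = Zero A T Y"
      using h Comp_assoc[OF h(1) assms(2,3)]
        is_mono_Zero_iff[OF assms(3,4) Comp_Hom[OF h(1) assms(2)]] by simp
    then show "\<exists>u \<in> Hom A T K. k \<cdot> u = h"
      using is_kernel_factor[OF assms(1) k(1) assms(2) h(1)] by metis
  qed
qed

lemmas is_cokernel_Comp_epi =
  preadditive_category.is_kernel_Comp_mono[OF preadditive_category_opp, unfolded opp_simps]

text \<open>\<open>f\<close> and \<open>k\<close> are both kernels of \<open>g\<close>, so each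
  factors through the other, and \<open>f\<close> inherits from \<open>k\<close> the universal
  property for \<open>g'\<close>. This serves to replace the kernel chosen in \<open>exact\<close>
  by \<open>f\<close> itself.\<close>

lemma is_kernel_transfer:
  assumes f: "f \<in> Hom A K X" "is_mono A f" and k: "is_kernel A k g" "is_kernel A k g'"
    and f': "is_kernel A f g"
  shows "is_kernel A f g'"
proof -
  obtain Y where g: "g \<in> Hom A X Y"
    using f' f unfolding is_kernel_def by (auto simp: Hom_def)
  obtain L where kX: "k \<in> Hom A L X" and gk: "g \<cdot> k = Zero A L Y"
    using is_kernel_Hom[OF k(1) g] .
  obtain Z where g': "g' \<in> Hom A X Z"
    using k(2) kX unfolding is_kernel_def by (auto simp: Hom_def)
  note g'k = is_kernel_Comp[OF k(2) kX g'] and gf = is_kernel_Comp[OF f' f(1) g]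
  obtain u where u: "u \<in> Hom A K L" "k \<cdot> u = f"
    using is_kernel_factor[OF k(1) kX g f(1) gf] .
  obtain v where v: "v \<in> Hom A L K" "f \<cdot> v = k"
    using is_kernel_factor[OF f' f(1) g kX gk] .
  show ?thesis
  proof (rule is_kernelI[OF f(1) g' _ f(2)])
    show "g' \<cdot> f = Zero A K Z"
      using Comp_assoc[OF u(1) kX g'] u g'k Zero_Comp[OF u(1)] Hom_Ob(2)[OF g'] by simp
    fix T h assume h: "h \<in> Hom A T X" "g' \<cdot> h = Zero A T Z"
    obtain w where w: "w \<in> Hom A T L" "k \<cdot> w = h"
      using is_kernel_factor[OF k(2) kX g' h] .
    have "f \<cdot> (v \<cdot> w) = h"
      using Comp_assoc[OF w(1) v(1) f(1)] v w by simp
    then show "\<exists>u \<in> Hom A T K. f \<cdot> u = h"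
      using Comp_Hom[OF w(1) v(1)] by blast
  qed
qed

lemma is_biproduct_swap:
  assumes "is_biproduct A X Y P i j p q"
  shows "is_biproduct A Y X P j i q p"
proof -
  have "i \<cdot> p \<in> Hom A P P" "j \<cdot> q \<in> Hom A P P"
    using assms Comp_Hom unfolding is_biproduct_def by blast+
  then show ?thesis
    using assms Add_comm[of "i \<cdot> p" P P "j \<cdot> q"] unfolding is_biproduct_def by simp
qed

end

section \<open>Exactness in abelian categories\<close>

context abelian_category
begin

text \<open>\<open>f\<close> is a kernel of some \<open>g\<close>, and \<open>g\<close> factors
  through \<open>c\<close> because it kills \<open>f\<close>. So whatever \<open>c\<close> kills is
  killed by \<open>g\<close> and lifts along \<open>f\<close>.\<close>

lemma is_mono_is_kernel_of_cokernel:
  assumes f: "f \<in> Hom A X Y" "is_mono A f" and c: "is_cokernel A c f"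
  shows "is_kernel A f c"
proof -
  obtain g where g: "is_kernel A f g"
    using mono_is_kernel[OF f(2)] by blast
  then obtain Z where gZ: "g \<in> Hom A Y Z"
    using f unfolding is_kernel_def by (auto simp: Hom_def)
  obtain C where cC: "c \<in> Hom A Y C" and cf: "c \<cdot> f = Zero A X C"
    using is_cokernel_Hom[OF c f(1)] .
  obtain u where u: "u \<in> Hom A C Z" "u \<cdot> c = g"
    using is_cokernel_factor[OF c cC f(1) gZ is_kernel_Comp[OF g f(1) gZ]] .
  show ?thesis
  proof (rule is_kernelI[OF f(1) cC cf f(2)])
    fix T h assume h: "h \<in> Hom A T Y" "c \<cdot> h = Zero A T C"
    have "g \<cdot> h = Zero A T Z"
      using Comp_assoc[OF h(1) cC u(1)] u h Comp_Zero[OF u(1)] Hom_Ob(1)[OF h(1)] by simp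
    then show "\<exists>u \<in> Hom A T X. f \<cdot> u = h"
      using is_kernel_factor[OF g f(1) gZ h(1)] by metis
  qed
qed

lemmas is_epi_is_cokernel_of_kernel =
  abelian_category.is_mono_is_kernel_of_cokernel[OF abelian_category_opp, unfolded opp_simps]

text \<open>The definition of \<open>exact\<close> is not visibly self-dual. The same two witnesses
  serve with their roles exchanged: \<open>k\<close> is a kernel of \<open>g\<close>, and
  \<open>c\<close>, being epi, is a cokernel of its kernel \<open>k\<close>.\<close>

lemma exact_oppI:
  assumes "exact A f g"
  shows "exact (opp A) g f"
proof -
  obtain c k where fg: "f \<in> Mor A" "g \<in> Mor A" "Cod A f = Dom A g"
    and c: "is_cokernel A c f" and k: "is_kernel A k c" "is_kernel A k g"
    using assms unfolding exact_def by blast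
  have "c \<in> Hom A (Dom A c) (Cod A c)"
    using c unfolding is_cokernel_def by (simp add: Hom_def)
  then have "is_cokernel A c k"
    using is_epi_is_cokernel_of_kernel is_cokernel_is_epi[OF c] k(1) by blast
  with fg c k show ?thesis
    unfolding exact_def opp_simps by (intro conjI exI[of _ k] exI[of _ c]) simp_all
qed

end

lemma exact_opp:
  assumes "abelian_category A"
  shows "exact (opp A) g f \<longleftrightarrow> exact A f g"
  using abelian_category.exact_oppI[OF assms, of f g]
    abelian_category.exact_oppI[OF abelian_category.abelian_category_opp[OF assms], of g f]
  by (auto simp: opp_opp)

lemma exact_from_zero_opp:
  assumes "abelian_category A"
  shows "exact_from_zero (opp A) f \<longleftrightarrow> exact_to_zero A f"
  by (simp add: exact_from_zero_def exact_to_zero_def opp_simps exact_opp[OF assms])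

context abelian_category
begin

text \<open>A monomorphism is its own image, namely a kernel of its cokernel.\<close>

lemma exact_mono_iff:
  assumes f: "f \<in> Hom A X Y" "is_mono A f"
  shows "exact A f g \<longleftrightarrow> is_kernel A f g"
proof
  assume "exact A f g"
  then obtain c k where c: "is_cokernel A c f" and k: "is_kernel A k c" "is_kernel A k g"
    unfolding exact_def by blast
  show "is_kernel A f g"
    using is_kernel_transfer[OF f k] is_mono_is_kernel_of_cokernel[OF f c] by blast
next
  assume g: "is_kernel A f g"
  obtain c where c: "is_cokernel A c f"
    using ex_cokernel f Hom_Mor by metis
  then show "exact A f g"
    using is_mono_is_kernel_of_cokernel[OF f c] g unfolding exact_def is_kernel_def by blast
qed

text \<open>A zero morphism out of a zero object is mono, so by \<open>exact_mono_iff\<close>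
  exactness says that it is a kernel of \<open>f\<close>; this holds exactly when \<open>f\<close>
  kills only zero morphisms.\<close>

lemma exact_from_zero_iff:
  assumes f: "f \<in> Hom A X Y"
  shows "exact_from_zero A f \<longleftrightarrow> is_mono A f"
proof
  have X: "X \<in> Ob A" using f Hom_Ob by blast
  have uniq: "t = t'" if "is_zero_object A Z" "t \<in> Hom A T Z" "t' \<in> Hom A T Z" for Z T t t'
    using that Hom_Ob unfolding is_zero_object_def by metis
  have mono: "Zero A Z X \<in> Hom A Z X" "is_mono A (Zero A Z X)" if Z: "is_zero_object A Z" for Z
  proof -
    show z: "Zero A Z X \<in> Hom A Z X"
      using Z X Zero_Hom unfolding is_zero_object_def by blast
    show "is_mono A (Zero A Z X)"
      unfolding is_mono_def using z uniq[OF Z] by (auto simp: Hom_simps)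
  qed
  {
    assume "exact_from_zero A f"
    then obtain Z where Z: "is_zero_object A Z" and "exact A (Zero A Z X) f"
      using f unfolding exact_from_zero_def by (auto simp: Hom_simps)
    then have ker: "is_kernel A (Zero A Z X) f"
      using exact_mono_iff mono by blast
    show "is_mono A f"
    proof (rule is_monoI[OF f])
      fix T t assume t: "t \<in> Hom A T X" "f \<cdot> t = Zero A T Y"
      obtain u where "u \<in> Hom A T Z" "Zero A Z X \<cdot> u = t"
        using is_kernel_factor[OF ker mono(1)[OF Z] f t] .
      then show "t = Zero A T X"
        using Zero_Comp X by metis
    qed
  next
    assume m: "is_mono A f"
    obtain Z where Z: "is_zero_object A Z"
      using ex_zero_object by blast
    have "is_kernel A (Zero A Z X) f"
    proof (rule is_kernelI[OF mono(1)[OF Z] f _ mono(2)[OF Z]])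
      show "f \<cdot> Zero A Z X = Zero A Z Y"
        using Comp_Zero f mono(1)[OF Z] Hom_Ob by blast
      fix T h assume h: "h \<in> Hom A T X" "f \<cdot> h = Zero A T Y"
      then have "h = Zero A T X"
        using is_mono_Zero_iff f m by blast
      moreover have "Zero A T Z \<in> Hom A T Z"
        using Zero_Hom h Z Hom_Ob unfolding is_zero_object_def by blast
      ultimately show "\<exists>u \<in> Hom A T Z. Zero A Z X \<cdot> u = h"
        using Zero_Comp X by blast
    qed
    then show "exact_from_zero A f"
      unfolding exact_from_zero_def
      using Z exact_mono_iff[OF mono[OF Z]] f by (auto simp: Hom_simps)
  }
qed

lemma exact_to_zero_iff:
  assumes "f \<in> Hom A X Y"
  shows "exact_to_zero A f \<longleftrightarrow> is_epi A f"
  using abelian_category.exact_from_zero_iff[OF abelian_category_opp, of f Y X] assms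
    exact_from_zero_opp[OF abelian_category_axioms] by (simp add: opp_simps)

text \<open>Exactness at the ends makes \<open>i\<close> mono and \<open>p\<close> epi; exactness in
  the middle then makes \<open>i\<close> a kernel of \<open>p\<close>, and an epimorphism is a
  cokernel of its kernel.\<close>

lemma short_exact_iff:
  assumes i: "i \<in> Hom A X Y" and p: "p \<in> Hom A Y Z"
  shows "short_exact A i p \<longleftrightarrow> is_kernel A i p \<and> is_cokernel A p i"
proof -
  have "is_cokernel A p i" if "is_kernel A i p" "is_epi A p"
    using is_epi_is_cokernel_of_kernel[OF p] that by blast
  then show ?thesis
    using exact_from_zero_iff[OF i] exact_to_zero_iff[OF p] exact_mono_iff[OF i]
      is_kernel_is_mono is_cokernel_is_epi
    unfolding short_exact_def by metis
qed

end


section \<open>Extending along a special preenvelope\<close>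

context abelian_category
begin

text \<open>
  The pushout of \<open>i\<close> along \<open>g\<close> is taken as the cokernel \<open>c\<close> of \<open>(i, g) : M \<rightarrow> X \<oplus> Y\<close>; there
  the sum, not the difference, of the two composites is zero, so that a retraction of the
  pushed out extension extends \<open>-g\<close>.
\<close>

lemma ex_extension_neg:
  assumes i: "i \<in> Hom A M X" and p: "p \<in> Hom A X C"
    and ker: "is_kernel A i p" and coker: "is_cokernel A p i"
    and split: "extensions A C Y \<subseteq> Ext1_zero A C Y"
    and g: "g \<in> Hom A M Y"
  shows "\<exists>t \<in> Hom A X Y. Add A (t \<cdot> i) g = Zero A M Y"
proof -
  have ob: "M \<in> Ob A" "X \<in> Ob A" "C \<in> Ob A" "Y \<in> Ob A"
    using i p g Hom_Ob by blast+
  note im = is_kernel_is_mono[OF ker] and pe = is_cokernel_is_epi[OF coker]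
  obtain P a b r s where "is_biproduct A X Y P a b r s"
    using ex_biproduct ob by blast
  then have a: "a \<in> Hom A X P" and b: "b \<in> Hom A Y P" and r: "r \<in> Hom A P X"
    and s: "s \<in> Hom A P Y" and ra: "r \<cdot> a = Ident A X" and sb: "s \<cdot> b = Ident A Y"
    and rb: "r \<cdot> b = Zero A Y X"
    and sum: "Add A (a \<cdot> r) (b \<cdot> s) = Ident A P"
    unfolding is_biproduct_def by blast+
  define \<phi> where "\<phi> = Add A (a \<cdot> i) (b \<cdot> g)"
  have ai: "a \<cdot> i \<in> Hom A M P" and bg: "b \<cdot> g \<in> Hom A M P"
    using a b i g Comp_Hom by blast+
  then have \<phi>: "\<phi> \<in> Hom A M P"
    unfolding \<phi>_def using Add_Hom by blast
  \<comment> \<open>The \<open>X\<close>-component of \<open>\<phi>\<close> is \<open>i\<close>, so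
    \<open>\<phi>\<close> is mono because \<open>i\<close> is.\<close>
  have r\<phi>: "r \<cdot> \<phi> = i"
    unfolding \<phi>_def
    using Comp_Add[OF ai bg r] Comp_assoc[OF i a r] Comp_assoc[OF g b r] ra rb
      Ident_Comp[OF i] Zero_Comp[OF g] Add_Zero[OF i] ob by simp
  have \<phi>m: "is_mono A \<phi>"
    using is_mono_Comp_right[OF \<phi> r] r\<phi> im by simp
  obtain c where c: "is_cokernel A c \<phi>"
    using ex_cokernel \<phi> Hom_Mor by metis
  then obtain E where cE: "c \<in> Hom A P E" and c\<phi>: "c \<cdot> \<phi> = Zero A M E"
    using is_cokernel_Hom[OF c \<phi>] by blast
  note ce = is_cokernel_is_epi[OF c] and \<phi>ker = is_mono_is_kernel_of_cokernel[OF \<phi> \<phi>m c]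
  have pr: "p \<cdot> r \<in> Hom A P C" and cb: "c \<cdot> b \<in> Hom A Y E"
    using p r cE b Comp_Hom by blast+
  \<comment> \<open>The map \<open>q\<close> from the pushout to \<open>C\<close> is induced by
    \<open>p\<close> on \<open>X\<close> and zero on \<open>Y\<close>.\<close>
  have "(p \<cdot> r) \<cdot> \<phi> = Zero A M C"
    using Comp_assoc[OF \<phi> r p] r\<phi> is_kernel_Comp[OF ker i p] by simp
  then obtain q where q: "q \<in> Hom A E C" and qc: "q \<cdot> c = p \<cdot> r"
    using is_cokernel_factor[OF c cE \<phi> pr] by metis
  have "p \<cdot> r \<cdot> a = p"
    using Comp_assoc[OF a r p] ra Comp_Ident[OF p] by simp
  then have "is_epi A (p \<cdot> r)"
    using is_epi_Comp_left[OF pr a] pe by simp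
  then have qe: "is_epi A q"
    using is_epi_Comp_left[OF q cE] qc by simp
  \<comment> \<open>If \<open>c\<close> kills \<open>b \<cdot> y\<close>, then
    \<open>b \<cdot> y = \<phi> \<cdot> z\<close> for some \<open>z\<close>. The
    \<open>X\<close>-components give \<open>i \<cdot> z\<close> zero, hence \<open>z\<close> and
    \<open>b \<cdot> y\<close> are zero, and \<open>s\<close> recovers \<open>y\<close>.\<close>
  have jm: "is_mono A (c \<cdot> b)"
  proof (rule is_monoI[OF cb])
    fix T y assume y: "y \<in> Hom A T Y" "c \<cdot> b \<cdot> y = Zero A T E"
    have by': "b \<cdot> y \<in> Hom A T P" using y b Comp_Hom by blast
    have T: "T \<in> Ob A" using y Hom_Ob by blast
    have "c \<cdot> (b \<cdot> y) = Zero A T E"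
      using Comp_assoc[OF y(1) b cE] y by simp
    then obtain z where z: "z \<in> Hom A T M" "\<phi> \<cdot> z = b \<cdot> y"
      using is_kernel_factor[OF \<phi>ker \<phi> cE by'] by blast
    have "i \<cdot> z = r \<cdot> (b \<cdot> y)"
      using Comp_assoc[OF z(1) \<phi> r] z r\<phi> by simp
    also have "\<dots> = Zero A T X"
      using Comp_assoc[OF y(1) b r] rb Zero_Comp[OF y(1)] ob by simp
    finally have "z = Zero A T M"
      using is_mono_Zero_iff[OF i im z(1)] by simp
    then have "b \<cdot> y = Zero A T P"
      using z Comp_Zero[OF \<phi> T] by simp
    then have "s \<cdot> (b \<cdot> y) = Zero A T Y"
      using Comp_Zero[OF s T] by simp
    then show "y = Zero A T Y"
      using Comp_assoc[OF y(1) b s] sb Ident_Comp[OF y(1)] by simp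
  qed
  have q_coker: "is_cokernel A q (c \<cdot> b)"
  proof (rule is_cokernelI[OF q cb _ qe])
    show "q \<cdot> (c \<cdot> b) = Zero A Y C"
      using Comp_assoc[OF b cE q] qc Comp_assoc[OF b r p] rb Comp_Zero[OF p] ob by simp
    fix T h assume h: "h \<in> Hom A E T" "h \<cdot> (c \<cdot> b) = Zero A Y T"
    have T: "T \<in> Ob A" using h Hom_Ob by blast
    have hc: "h \<cdot> c \<in> Hom A P T" and hca: "h \<cdot> c \<cdot> a \<in> Hom A X T"
      using h cE a Comp_Hom by blast+
    have hcb: "h \<cdot> c \<cdot> b = Zero A Y T"
      using h Comp_assoc[OF b cE h(1)] by simp
    \<comment> \<open>As \<open>h \<cdot> c\<close> vanishes on the summand \<open>Y\<close>, only
      its part through \<open>X\<close> survives.\<close>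
    have hcar: "h \<cdot> c = h \<cdot> c \<cdot> a \<cdot> r"
    proof -
      have ar: "a \<cdot> r \<in> Hom A P P" and bs: "b \<cdot> s \<in> Hom A P P"
        using a r b s Comp_Hom by blast+
      have "h \<cdot> c = h \<cdot> c \<cdot> Add A (a \<cdot> r) (b \<cdot> s)"
        using sum Comp_Ident[OF hc] by simp
      also have "\<dots> = Add A (h \<cdot> c \<cdot> a \<cdot> r) (h \<cdot> c \<cdot> b \<cdot> s)"
        using Comp_Add[OF ar bs hc] Comp_assoc[OF r a hc] Comp_assoc[OF s b hc] by simp
      also have "\<dots> = h \<cdot> c \<cdot> a \<cdot> r"
        using hcb Zero_Comp[OF s T] Add_Zero[OF Comp_Hom[OF r hca]] by simp
      finally show ?thesis .
    qed
    \<comment> \<open>Since \<open>c\<close> kills \<open>\<phi>\<close>, the restriction of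
      \<open>h \<cdot> c\<close> to \<open>X\<close> kills \<open>i\<close> and factors through the
      cokernel \<open>p\<close>; the factor \<open>u\<close> is the required map on
      \<open>C\<close>.\<close>
    have "h \<cdot> c \<cdot> a \<cdot> i = h \<cdot> c \<cdot> a \<cdot> (r \<cdot> \<phi>)"
      using r\<phi> by simp
    also have "\<dots> = h \<cdot> c \<cdot> \<phi>"
      using Comp_assoc[OF \<phi> r hca] hcar by simp
    also have "\<dots> = Zero A M T"
      using Comp_assoc[OF \<phi> cE h(1)] c\<phi> Comp_Zero[OF h(1)] ob by simp
    finally obtain u where u: "u \<in> Hom A C T" "u \<cdot> p = h \<cdot> c \<cdot> a"
      using is_cokernel_factor[OF coker p i hca] by metis
    have "(u \<cdot> q) \<cdot> c = h \<cdot> c"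
      using Comp_assoc[OF cE q u(1)] qc Comp_assoc[OF r p u(1)] u hcar by simp
    then have "u \<cdot> q = h"
      using is_epi_cancel[OF ce cE Comp_Hom[OF q u(1)] h(1)] by blast
    then show "\<exists>u \<in> Hom A C T. u \<cdot> q = h"
      using u by blast
  qed
  have "short_exact A (c \<cdot> b) q"
    using short_exact_iff[OF cb q] is_mono_is_kernel_of_cokernel[OF cb jm] q_coker by blast
  then have "(c \<cdot> b, q) \<in> Ext1_zero A C Y"
    using split cb q unfolding extensions_def by blast
  then obtain \<rho> where \<rho>: "\<rho> \<in> Hom A E Y" "\<rho> \<cdot> (c \<cdot> b) = Ident A Y"
    using cb unfolding Ext1_zero_def is_biproduct_def by (auto simp: Hom_def)
  have \<rho>c: "\<rho> \<cdot> c \<in> Hom A P Y"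
    using \<rho> cE Comp_Hom by blast
  have \<rho>cb: "\<rho> \<cdot> c \<cdot> b = Ident A Y"
    using \<rho> Comp_assoc[OF b cE \<rho>(1)] by simp
  \<comment> \<open>The witness is \<open>\<rho> \<cdot> c \<cdot> a\<close>: the map
    \<open>\<rho> \<cdot> c\<close> is the identity on \<open>Y\<close> and kills
    \<open>\<phi>\<close>.\<close>
  have "Add A (\<rho> \<cdot> c \<cdot> a \<cdot> i) g = Add A (\<rho> \<cdot> c \<cdot> (a \<cdot> i)) (\<rho> \<cdot> c \<cdot> (b \<cdot> g))"
    using Comp_assoc[OF i a \<rho>c] Comp_assoc[OF g b \<rho>c] \<rho>cb Ident_Comp[OF g] by simp
  also have "\<dots> = \<rho> \<cdot> c \<cdot> \<phi>"
    unfolding \<phi>_def using Comp_Add[OF ai bg \<rho>c] by simp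
  also have "\<dots> = Zero A M Y"
    using Comp_assoc[OF \<phi> cE \<rho>(1)] c\<phi> Comp_Zero[OF \<rho>(1)] ob by simp
  finally show ?thesis
    using Comp_Hom[OF a \<rho>c] by blast
qed

text \<open>Applying \<open>ex_extension_neg\<close> to the negative of \<open>g\<close> removes the
  sign.\<close>

lemma ex_extension:
  assumes i: "i \<in> Hom A M X" and p: "p \<in> Hom A X C"
    and "is_kernel A i p" "is_cokernel A p i"
    and "extensions A C Y \<subseteq> Ext1_zero A C Y"
    and g: "g \<in> Hom A M Y"
  shows "\<exists>t \<in> Hom A X Y. t \<cdot> i = g"
proof -
  obtain g' where g': "g' \<in> Hom A M Y" "Add A g g' = Zero A M Y"
    using ex_negative[OF g] by metis
  obtain t where t: "t \<in> Hom A X Y" "Add A (t \<cdot> i) g' = Zero A M Y"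
    using ex_extension_neg[OF assms(1-5) g'(1)] by blast
  then have "t \<cdot> i = g"
    using Add_cancel_right[OF Comp_Hom[OF i t(1)] g g'(1)] g' by simp
  with t show ?thesis by blast
qed

text \<open>Every extension lies in its own class, by the identity isomorphism, and the only class
  is that of the direct sum extensions.\<close>

lemma extensions_subset_Ext1_zero:
  assumes "Ext1_vanishes A M N"
  shows "extensions A M N \<subseteq> Ext1_zero A M N"
proof
  fix e assume e: "e \<in> extensions A M N"
  then obtain i p E where ip: "e = (i, p)" "i \<in> Hom A N E" "p \<in> Hom A E M"
    unfolding extensions_def by blast
  have "(e, e) \<in> ext_equiv A M N"
  proof -
    have "E \<in> Ob A" using ip Hom_Ob by blast
    then have "\<exists>u \<in> Hom A (Cod A i) (Cod A i). is_iso A u \<and> u \<cdot> i = i \<and> p \<cdot> u = p"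
      using is_iso_Ident Ident_Hom Ident_Comp[OF ip(2)] Comp_Ident[OF ip(3)] Hom_Cod[OF ip(2)]
      by metis
    then show ?thesis
      using e ip(1) unfolding ext_equiv_def by simp
  qed
  moreover have "ext_equiv A M N `` {e} = Ext1_zero A M N"
    using assms quotientI[OF e, of "ext_equiv A M N"] unfolding Ext1_vanishes_def Ext1_def by simp
  ultimately show "e \<in> Ext1_zero A M N" by blast
qed

text \<open>Reversing arrows swaps the two ends of an extension, and a biproduct stays a biproduct
  with injections and projections exchanged. Thus splitting passes to \<open>opp A\<close>.\<close>

lemma extensions_opp_subset:
  assumes "extensions A M N \<subseteq> Ext1_zero A M N"
  shows "extensions (opp A) N M \<subseteq> Ext1_zero (opp A) N M"
proof
  fix x assume "x \<in> extensions (opp A) N M"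
  then obtain i p E where x: "x = (i, p)" and ip: "i \<in> Hom A E M" "p \<in> Hom A N E"
    and "short_exact (opp A) i p"
    unfolding extensions_def Hom_opp by blast
  then have "is_kernel A p i" "is_cokernel A i p"
    using abelian_category.short_exact_iff[OF abelian_category_opp, of i M E p N]
    by (simp_all add: opp_simps)
  then have "(p, i) \<in> extensions A M N"
    unfolding extensions_def using ip short_exact_iff by blast
  then obtain E' r s where "is_biproduct A N M E' p s r i"
    using assms unfolding Ext1_zero_def by blast
  then have "is_biproduct (opp A) M N E' i r s p"
    using is_biproduct_swap by (simp add: is_biproduct_opp)
  then show "x \<in> Ext1_zero (opp A) N M"
    unfolding x Ext1_zero_def by blast
qed

text \<open>Read in \<open>A\<close>, this lifts morphisms along a cokernel. The splitting
  hypothesis still speaks of \<open>opp A\<close>; \<open>extensions_opp_subset\<close> supplies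
  it.\<close>

lemmas ex_lift = abelian_category.ex_extension[OF abelian_category_opp, unfolded opp_simps]

end

section \<open>Proper coresolutions\<close>

text \<open>What is kept of a special preenvelope once Ext has been used. In \<open>opp A\<close> it
  is an epimorphism onto \<open>M\<close> along which morphisms from \<open>V\<close> lift, so one
  construction yields both kinds of resolution.\<close>

definition mono_preenvelope ::
    "('o, 'm) add_category \<Rightarrow> 'o set \<Rightarrow> 'o \<Rightarrow> 'o \<Rightarrow> 'm \<Rightarrow> bool" where
  "mono_preenvelope A V M X i \<longleftrightarrow> X \<in> V \<and> i \<in> Hom A M X \<and> is_mono A i \<and>
    (\<forall>Y \<in> V. \<forall>g \<in> Hom A M Y. \<exists>t \<in> Hom A X Y. t \<cdot>\<^bsub>A\<^esub> i = g)"

context abelian_category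
begin

lemma special_preenveloping_mono_preenvelope:
  assumes "special_preenveloping A V" "M \<in> Ob A"
  shows "\<exists>X i. mono_preenvelope A V M X i"
proof -
  obtain X C i p where X: "X \<in> V" and C: "C \<in> left_perp A V"
    and i: "i \<in> Hom A M X" and p: "p \<in> Hom A X C" and "short_exact A i p"
    using assms unfolding special_preenveloping_def by blast
  then have ip: "is_kernel A i p" "is_cokernel A p i"
    using short_exact_iff by blast+
  have "\<exists>t \<in> Hom A X Y. t \<cdot> i = g" if "Y \<in> V" "g \<in> Hom A M Y" for Y g
    using ex_extension[OF i p ip extensions_subset_Ext1_zero that(2)] C that
    unfolding left_perp_def by blast
  then show ?thesis
    unfolding mono_preenvelope_def using X i is_kernel_is_mono[OF ip(1)] by blast
qed

lemma special_precovering_mono_preenvelope_opp: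
  assumes "special_precovering A W" "M \<in> Ob A"
  shows "\<exists>X i. mono_preenvelope (opp A) W M X i"
proof -
  obtain X K i p where X: "X \<in> W" and K: "K \<in> right_perp A W"
    and i: "i \<in> Hom A K X" and p: "p \<in> Hom A X M" and "short_exact A i p"
    using assms unfolding special_precovering_def by blast
  then have ip: "is_kernel A i p" "is_cokernel A p i"
    using short_exact_iff by blast+
  have "\<exists>t \<in> Hom A Y X. p \<cdot> t = g" if "Y \<in> W" "g \<in> Hom A Y M" for Y g
    using ex_lift[OF p i ip(2,1) extensions_opp_subset[OF extensions_subset_Ext1_zero] that(2)] K that
    unfolding right_perp_def by blast
  then show ?thesis
    unfolding mono_preenvelope_def opp_simps using X p is_cokernel_is_epi[OF ip(2)] by blast
qed

text \<open>Composing with the epimorphism \<open>p\<close> preserves the cokernel \<open>q\<close>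
  of \<open>e\<close>, and composing with the monomorphism \<open>m\<close> preserves the kernel
  \<open>e\<close> of \<open>q\<close>. This gives exactness at a splice.\<close>

lemma exact_Comp_epi_mono:
  assumes p: "p \<in> Hom A X C" and e: "e \<in> Hom A C Y" and q: "q \<in> Hom A Y D" and m: "m \<in> Hom A D Z"
    and "is_epi A p" "is_mono A e" "is_cokernel A q e" "is_mono A m"
  shows "exact A (e \<cdot> p) (m \<cdot> q)"
proof -
  have "is_kernel A e q"
    using is_mono_is_kernel_of_cokernel[OF e] assms by blast
  moreover have "is_kernel A e (m \<cdot> q)"
    using is_kernel_Comp_mono[OF calculation q m] assms by blast
  moreover have "is_cokernel A q (e \<cdot> p)"
    using is_cokernel_Comp_epi[OF _ e p] assms by blast
  ultimately show ?thesis
    using Comp_Hom[OF p e] Comp_Hom[OF q m] unfolding exact_def by (auto simp: Hom_simps)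
qed

section \<open>Exactness of spliced sequences under Hom(-, Y)\<close>

lemma kernel_HomInto:
  "kernel (Fob (HomInto A Y) X') (Fob (HomInto A Y) X) (Fmor (HomInto A Y) f)
    = {h \<in> Hom A X' Y. h \<cdot> f = Zero A X Y}"
  by (simp add: kernel_def HomInto_def HomGrp_def)

lemma image_HomInto:
  "Fmor (HomInto A Y) f ` carrier (Fob (HomInto A Y) X) = (\<lambda>h. h \<cdot> f) ` Hom A X Y"
  by (simp add: HomInto_def HomGrp_def)

text \<open>As \<open>f\<close> is epi, \<open>q\<close> is also a cokernel of
  \<open>e \<cdot> f\<close>. A morphism killing \<open>e \<cdot> f\<close> therefore factors
  through \<open>q\<close>, and the factor extends along \<open>m\<close>.\<close>

lemma image_Hom_eq_kernel:
  assumes f: "f \<in> Hom A T C" and e: "e \<in> Hom A C X" and q: "q \<in> Hom A X D" and m: "m \<in> Hom A D X'"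
    and "is_epi A f" and coker: "is_cokernel A q e"
    and ext: "\<forall>g \<in> Hom A D Y. \<exists>t \<in> Hom A X' Y. t \<cdot> m = g"
  shows "(\<lambda>h. h \<cdot> (m \<cdot> q)) ` Hom A X' Y = {h \<in> Hom A X Y. h \<cdot> (e \<cdot> f) = Zero A T Y}"
proof -
  have coker': "is_cokernel A q (e \<cdot> f)"
    using is_cokernel_Comp_epi[OF coker e f] assms by blast
  have ef: "e \<cdot> f \<in> Hom A T X" and mq: "m \<cdot> q \<in> Hom A X X'"
    using Comp_Hom f e m q by blast+
  have "h \<cdot> (m \<cdot> q) \<cdot> (e \<cdot> f) = Zero A T Y" if h: "h \<in> Hom A X' Y" for h
  proof -
    have "h \<cdot> (m \<cdot> q) \<cdot> (e \<cdot> f) = h \<cdot> m \<cdot> (q \<cdot> (e \<cdot> f))"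
      using Comp_assoc[OF ef q Comp_Hom[OF m h]] Comp_assoc[OF q m h] by simp
    also have "\<dots> = Zero A T Y"
      using is_cokernel_Comp[OF coker' q ef] Comp_Zero[OF Comp_Hom[OF m h]] Hom_Ob(1)[OF f] by simp
    finally show ?thesis .
  qed
  moreover have "\<exists>t \<in> Hom A X' Y. h = t \<cdot> (m \<cdot> q)"
    if h: "h \<in> Hom A X Y" "h \<cdot> (e \<cdot> f) = Zero A T Y" for h
  proof -
    obtain u where u: "u \<in> Hom A D Y" "u \<cdot> q = h"
      using is_cokernel_factor[OF coker' q ef h] .
    then obtain t where t: "t \<in> Hom A X' Y" "t \<cdot> m = u"
      using ext by blast
    then have "h = t \<cdot> (m \<cdot> q)"
      using Comp_assoc[OF q m t(1)] u by simp
    with t show ?thesis by blast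
  qed
  ultimately show ?thesis
    using Comp_Hom[OF mq] by blast
qed

text \<open>Splice the sequences \<open>0 \<rightarrow> C n \<rightarrow> I n \<rightarrow> C (n + 1) \<rightarrow> 0\<close> given by preenvelopes \<open>e\<close>.\<close>

lemma ex_proper_coresolution:
  assumes pre: "\<And>M. M \<in> Ob A \<Longrightarrow> \<exists>X i. mono_preenvelope A V M X i"
    and M: "M \<in> Ob A"
  shows "\<exists>I \<delta> d. proper_coresolution A V M I \<delta> d"
proof -
  obtain E e where Ee: "mono_preenvelope A V X (E X) (e X)" if "X \<in> Ob A" for X
    using pre by metis
  have "\<exists>q. is_cokernel A q (e X)" if "X \<in> Ob A" for X
    using Ee[OF that] ex_cokernel unfolding mono_preenvelope_def is_mono_def by blast
  then obtain q where q: "is_cokernel A (q X) (e X)" if "X \<in> Ob A" for X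
    by metis
  \<comment> \<open>\<open>C n\<close> is the \<open>n\<close>-th cosyzygy of \<open>M\<close>: the
    cokernel \<open>q (C n)\<close> of its embedding \<open>e (C n)\<close> ends in
    \<open>C (Suc n)\<close>.\<close>
  define C where "C n = ((\<lambda>X. Cod A (q X)) ^^ n) M" for n
  have e_Hom: "e X \<in> Hom A X (E X)" and e_mono: "is_mono A (e X)" and E: "E X \<in> V"
    and ext: "\<And>Y g. \<lbrakk>Y \<in> V; g \<in> Hom A X Y\<rbrakk> \<Longrightarrow> \<exists>t \<in> Hom A (E X) Y. t \<cdot> e X = g"
    if "X \<in> Ob A" for X
    using Ee[OF that] unfolding mono_preenvelope_def by blast+
  have q_Hom: "q X \<in> Hom A (E X) (Cod A (q X))" if "X \<in> Ob A" for X
    using is_cokernel_Hom[OF q[OF that] e_Hom[OF that]] by (metis Hom_Cod)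
  have C_Ob: "C n \<in> Ob A" for n
  proof (induction n)
    case (Suc n)
    then show ?case
      using q_Hom[OF Suc] Hom_Ob by (simp add: C_def)
  qed (simp add: C_def M)
  have C0: "C 0 = M" and C_Suc: "C (Suc n) = Cod A (q (C n))" for n
    by (simp_all add: C_def)
  note eC = e_Hom[OF C_Ob] and emC = e_mono[OF C_Ob] and qcC = q[OF C_Ob]
    and qC = q_Hom[OF C_Ob, folded C_Suc] and extC = ext[OF C_Ob]
  have qeC: "is_epi A (q (C n))" for n
    using is_cokernel_is_epi[OF qcC] .
  define I where "I n = E (C n)" for n
  define \<delta> where "\<delta> n = e (C (Suc n)) \<cdot> q (C n)" for n
  have \<delta>: "\<delta> n \<in> Hom A (I n) (I (Suc n))" for n
    unfolding \<delta>_def I_def by (rule Comp_Hom[OF qC eC])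
  have d: "e M \<in> Hom A M (I 0)"
    using eC[of 0] by (simp add: C0 I_def)
  \<comment> \<open>Taking the identity of \<open>M\<close> as the epimorphism onto
    \<open>C 0\<close> lets the splicing lemmas also cover exactness at \<open>I 0\<close>.\<close>
  have idM: "Ident A M \<in> Hom A M (C 0)" "is_epi A (Ident A M)" "e (C 0) \<cdot> Ident A M = e M"
    using M Ident_Hom is_epi_Ident Comp_Ident[OF eC[of 0, unfolded C0]] by (simp_all add: C0)
  have "proper_coresolution A V M I \<delta> (e M)"
    unfolding proper_coresolution_def Let_def
  proof (intro conjI allI ballI)
    show "I n \<in> V" for n
      unfolding I_def by (rule E[OF C_Ob])
    show "\<delta> n \<in> Hom A (I n) (I (Suc n))" for n
      by (rule \<delta>)
    show "e M \<in> Hom A M (I 0)"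
      by (rule d)
    show "exact_from_zero A (e M)"
      using exact_from_zero_iff[OF d] e_mono[OF M] by blast
    show "exact A (e M) (\<delta> 0)"
      using exact_Comp_epi_mono[OF idM(1) eC qC eC idM(2) emC qcC emC] idM(3)
      by (simp add: \<delta>_def)
    show "exact A (\<delta> n) (\<delta> (Suc n))" for n
      unfolding \<delta>_def by (rule exact_Comp_epi_mono[OF qC eC qC eC qeC emC qcC emC])
  next
    fix Y assume Y: "Y \<in> V"
    have ext': "\<forall>g \<in> Hom A (C n) Y. \<exists>t \<in> Hom A (E (C n)) Y. t \<cdot> e (C n) = g" for n
      using extC[OF Y] by blast
    show "Fmor (HomInto A Y) (e M) ` carrier (Fob (HomInto A Y) (I 0)) = carrier (Fob (HomInto A Y) M)"
      using ext'[of 0] Comp_Hom[OF d, of _ Y] unfolding image_HomInto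
      by (auto simp: HomInto_def HomGrp_def I_def C0)
    show "Fmor (HomInto A Y) (\<delta> 0) ` carrier (Fob (HomInto A Y) (I 1))
        = kernel (Fob (HomInto A Y) (I 0)) (Fob (HomInto A Y) M) (Fmor (HomInto A Y) (e M))"
      using image_Hom_eq_kernel[OF idM(1) eC qC eC idM(2) qcC ext'] idM(3)
      unfolding image_HomInto kernel_HomInto by (simp add: I_def \<delta>_def)
    show "Fmor (HomInto A Y) (\<delta> (Suc n)) ` carrier (Fob (HomInto A Y) (I (Suc (Suc n))))
        = kernel (Fob (HomInto A Y) (I (Suc n))) (Fob (HomInto A Y) (I n)) (Fmor (HomInto A Y) (\<delta> n))"
      for n
      using image_Hom_eq_kernel[OF qC eC qC eC qeC qcC ext']
      unfolding image_HomInto kernel_HomInto by (simp add: I_def \<delta>_def)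
  qed
  then show ?thesis by blast
qed

end

section \<open>The stable Hom functor\<close>

context abelian_category
begin

text \<open>Zero factors through a zero object of \<open>V\<close>, a negative is absorbed by the
  second factor, and a sum factors through a biproduct in \<open>V\<close>.\<close>

lemma subgroup_factor_Hom:
  assumes V: "subcategory A V" and M: "M \<in> Ob A" and N: "N \<in> Ob A"
  shows "subgroup (factor_Hom A V M N) (HomGrp A M N)"
proof -
  interpret G: comm_group "HomGrp A M N"
    using M N comm_group_Hom by blast
  have memI: "h \<cdot> g \<in> factor_Hom A V M N" if "X \<in> V" "g \<in> Hom A M X" "h \<in> Hom A X N" for X g h
    using that Comp_Hom unfolding factor_Hom_def by blast
  show ?thesis
  proof (rule G.subgroupI)
    show "factor_Hom A V M N \<subseteq> carrier (HomGrp A M N)"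
      by (auto simp: factor_Hom_def HomGrp_def)
    obtain Z where "Z \<in> V" "is_zero_object A Z"
      using V unfolding subcategory_def by blast
    then show "factor_Hom A V M N \<noteq> {}"
      using memI[of Z "Zero A M Z" "Zero A Z N"] Zero_Hom M N unfolding is_zero_object_def by blast
  next
    fix f assume "f \<in> factor_Hom A V M N"
    then obtain X g h where X: "X \<in> V" and g: "g \<in> Hom A M X" and h: "h \<in> Hom A X N"
      and f: "f = h \<cdot> g"
      unfolding factor_Hom_def by blast
    obtain h' where h': "h' \<in> Hom A X N" "Add A h' h = Zero A X N"
      using ex_negative[OF h] by metis
    have "Add A (h' \<cdot> g) f = Zero A M N"
      using Add_Comp[OF g h'(1) h] h'(2) Zero_Comp[OF g N] f by simp
    then have "inv\<^bsub>HomGrp A M N\<^esub> f = h' \<cdot> g"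
      using G.inv_equality[of "h' \<cdot> g" f] Comp_Hom[OF g h] Comp_Hom[OF g h'(1)] f
      by (simp add: HomGrp_def)
    then show "inv\<^bsub>HomGrp A M N\<^esub> f \<in> factor_Hom A V M N"
      using memI[OF X g h'(1)] by simp
  next
    fix f\<^sub>1 f\<^sub>2 assume "f\<^sub>1 \<in> factor_Hom A V M N" "f\<^sub>2 \<in> factor_Hom A V M N"
    then obtain X g h Y k l where X: "X \<in> V" and g: "g \<in> Hom A M X" and h: "h \<in> Hom A X N"
      and f\<^sub>1: "f\<^sub>1 = h \<cdot> g" and Y: "Y \<in> V" and k: "k \<in> Hom A M Y" and l: "l \<in> Hom A Y N"
      and f\<^sub>2: "f\<^sub>2 = l \<cdot> k"
      unfolding factor_Hom_def by blast
    obtain P i j p q where P: "P \<in> V" and "is_biproduct A X Y P i j p q"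
      using V X Y unfolding subcategory_def by blast
    then have i: "i \<in> Hom A X P" and j: "j \<in> Hom A Y P" and p: "p \<in> Hom A P X"
      and q: "q \<in> Hom A P Y" and pi: "p \<cdot> i = Ident A X" and qj: "q \<cdot> j = Ident A Y"
      and qi: "q \<cdot> i = Zero A X Y" and pj: "p \<cdot> j = Zero A Y X"
      unfolding is_biproduct_def by blast+
    \<comment> \<open>\<open>a\<close> has components \<open>g\<close> and \<open>k\<close>; the map
      out of \<open>P\<close> restricts to \<open>h\<close> on \<open>X\<close> and \<open>l\<close>
      on \<open>Y\<close>.\<close>
    define a where "a = Add A (i \<cdot> g) (j \<cdot> k)"
    have ig: "i \<cdot> g \<in> Hom A M P" and jk: "j \<cdot> k \<in> Hom A M P"
      and hp: "h \<cdot> p \<in> Hom A P N" and lq: "l \<cdot> q \<in> Hom A P N"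
      using i g j k h p l q Comp_Hom by blast+
    then have a: "a \<in> Hom A M P" and b: "Add A (h \<cdot> p) (l \<cdot> q) \<in> Hom A P N"
      unfolding a_def using Add_Hom by blast+
    have ob: "X \<in> Ob A" "Y \<in> Ob A"
      using g k Hom_Ob by blast+
    have "p \<cdot> a = g"
      unfolding a_def using Comp_Add[OF ig jk p] Comp_assoc[OF g i p] Comp_assoc[OF k j p]
        pi pj Ident_Comp[OF g] Zero_Comp[OF k] Add_Zero[OF g] ob by simp
    moreover have "q \<cdot> a = k"
      unfolding a_def using Comp_Add[OF ig jk q] Comp_assoc[OF g i q] Comp_assoc[OF k j q]
        qi qj Ident_Comp[OF k] Zero_Comp[OF g] Zero_Add[OF k] ob by simp
    ultimately have "Add A (h \<cdot> p) (l \<cdot> q) \<cdot> a = Add A f\<^sub>1 f\<^sub>2"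
      using Add_Comp[OF a hp lq] Comp_assoc[OF a p h] Comp_assoc[OF a q l] f\<^sub>1 f\<^sub>2 by simp
    then show "f\<^sub>1 \<otimes>\<^bsub>HomGrp A M N\<^esub> f\<^sub>2 \<in> factor_Hom A V M N"
      using memI[OF P a b] by (simp add: HomGrp_def)
  qed
qed

text \<open>Both sides divide \<open>HomGrp A M N\<close> by a set of morphisms. Once the image of
  \<open>rho_V\<close> is shown to be \<open>factor_Hom A V M N\<close>, the quotients are literally
  equal.\<close>

lemma stable_Hom_V_eq:
  assumes "proper_coresolution A V M I \<delta> d" and N: "N \<in> Ob A"
  shows "stable_Hom_V A I \<delta> d M N = HomGrp A M N Mod factor_Hom A V M N"
proof -
  have I: "\<And>n. I n \<in> V" and d: "d \<in> Hom A M (I 0)" and \<delta>: "\<delta> 0 \<in> Hom A (I 0) (I 1)"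
    and m: "is_mono A d" and ex: "exact A d (\<delta> 0)"
    and ext: "\<And>X. X \<in> V \<Longrightarrow> (\<lambda>h. h \<cdot> d) ` Hom A (I 0) X = Hom A M X"
    using assms exact_from_zero_iff unfolding proper_coresolution_def
    by (auto simp: Let_def HomInto_def HomGrp_def)
  have I1: "I 1 \<in> Ob A" using \<delta> Hom_Ob by blast
  have \<delta>d: "\<delta> 0 \<cdot> d = Zero A M (I 1)"
    using exact_mono_iff[OF d m] ex is_kernel_Comp[OF _ d \<delta>] by blast
  \<comment> \<open>\<open>K\<close> is what \<open>L0_V\<close> divides out; precomposition with
    \<open>d\<close> kills it because \<open>\<delta> 0 \<cdot> d\<close> is zero.\<close>
  define K where "K = (\<lambda>h. h \<cdot> \<delta> 0) ` Hom A (I 1) N"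
  have K: "k \<in> Hom A (I 0) N \<and> k \<cdot> d = Zero A M N" if "k \<in> K" for k
    using that Comp_Hom[OF \<delta>] Comp_assoc[OF d \<delta>] \<delta>d Comp_Zero Hom_Ob(1)[OF d]
    unfolding K_def by fastforce
  \<comment> \<open>An empty \<open>K\<close> would give empty cosets, on which
    \<open>the_elem\<close> is unspecified.\<close>
  have "K \<noteq> {}"
    unfolding K_def using Zero_Hom[OF I1 N] by blast
  have rho: "rho_V (HomInto A N) d (K #>\<^bsub>HomGrp A (I 0) N\<^esub> h) = h \<cdot> d" if h: "h \<in> Hom A (I 0) N" for h
  proof -
    \<comment> \<open>All elements of the coset of \<open>h\<close> have the same composite with
      \<open>d\<close>, so \<open>the_elem\<close> meets a singleton.\<close>
    have "Add A k h \<cdot> d = h \<cdot> d" if "k \<in> K" for k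
      using K[OF that] Add_Comp[OF d _ h, of k] Zero_Add[OF Comp_Hom[OF d h]] by simp
    then have "(\<lambda>x. x \<cdot> d) ` (K #>\<^bsub>HomGrp A (I 0) N\<^esub> h) = {h \<cdot> d}"
      using \<open>K \<noteq> {}\<close> by (force simp: r_coset_def HomGrp_def image_iff)
    then show ?thesis
      by (simp add: rho_V_def HomInto_def)
  qed
  have "rho_V (HomInto A N) d ` carrier (L0_V (HomInto A N) I \<delta>) = (\<lambda>h. h \<cdot> d) ` Hom A (I 0) N"
  proof -
    have "carrier (L0_V (HomInto A N) I \<delta>) = (\<lambda>h. K #>\<^bsub>HomGrp A (I 0) N\<^esub> h) ` Hom A (I 0) N"
      unfolding L0_V_def Coker_def FactGroup_def RCOSETS_def K_def
      by (auto simp: HomInto_def HomGrp_def)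
    then show ?thesis
      using rho by (simp add: image_image)
  qed
  also have "\<dots> = factor_Hom A V M N"
  proof
    show "(\<lambda>h. h \<cdot> d) ` Hom A (I 0) N \<subseteq> factor_Hom A V M N"
      using I d Comp_Hom[OF d] unfolding factor_Hom_def by blast
    show "factor_Hom A V M N \<subseteq> (\<lambda>h. h \<cdot> d) ` Hom A (I 0) N"
    proof
      fix f assume "f \<in> factor_Hom A V M N"
      then obtain X g h where X: "X \<in> V" and g: "g \<in> Hom A M X" and h: "h \<in> Hom A X N"
        and f: "f = h \<cdot> g"
        unfolding factor_Hom_def by blast
      \<comment> \<open>Properness at the object \<open>X\<close> of \<open>V\<close> turns a
        factorisation through \<open>X\<close> into one through \<open>I 0\<close>.\<close>
      obtain t where t: "t \<in> Hom A (I 0) X" "g = t \<cdot> d"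
        using ext[OF X] g by blast
      then show "f \<in> (\<lambda>h. h \<cdot> d) ` Hom A (I 0) N"
        using f Comp_assoc[OF d t(1) h] Comp_Hom[OF t(1) h] by blast
    qed
  qed
  finally show ?thesis
    unfolding stable_Hom_V_def stable_V_def Coker_def by (simp add: HomInto_def)
qed

end

section \<open>Duality for resolutions and stable functors, and the result\<close>

lemma HomInto_opp: "HomInto (opp A) N = HomFrom A N"
  by (simp add: HomInto_def HomFrom_def opp_simps)

lemma proper_coresolution_opp:
  assumes "abelian_category A"
  shows "proper_coresolution (opp A) W N P \<delta> f \<longleftrightarrow> proper_resolution A W N P \<delta> f"
  by (simp add: proper_coresolution_def proper_resolution_def HomInto_opp Hom_opp
      exact_opp[OF assms] exact_from_zero_opp[OF assms])

lemma stable_Hom_V_opp: "stable_Hom_V (opp A) P \<delta> f N M = stable_Hom_W A P \<delta> f M N"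
  by (simp add: stable_Hom_V_def stable_Hom_W_def stable_V_def stable_W_def L0_V_def L0_W_def
      rho_V_def rho_W_def HomInto_opp)

lemma factor_Hom_opp: "factor_Hom (opp A) W N M = factor_Hom A W M N"
  by (auto simp: factor_Hom_def opp_simps)

text \<open>The equalities hold for every choice of proper (co)resolution; the existence clauses
  ensure that they are not vacuous.\<close>

theorem proposition2p4:
  fixes A :: "('o, 'm) add_category" and V W :: "'o set" and M N :: 'o
  assumes "abelian_category A"
    and "subcategory A V" and "special_preenveloping A V"
    and "subcategory A W" and "special_precovering A W"
    and "M \<in> Ob A" and "N \<in> Ob A"
  shows "(\<exists>I \<delta> d. proper_coresolution A V M I \<delta> d) \<and>
    subgroup (factor_Hom A V M N) (HomGrp A M N) \<and>
    (\<forall>I \<delta> d. proper_coresolution A V M I \<delta> d \<longrightarrow>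
      stable_Hom_V A I \<delta> d M N = HomGrp A M N Mod factor_Hom A V M N) \<and>
    (\<exists>P \<delta> f. proper_resolution A W N P \<delta> f) \<and>
    subgroup (factor_Hom A W M N) (HomGrp A M N) \<and>
    (\<forall>P \<delta> f. proper_resolution A W N P \<delta> f \<longrightarrow>
      stable_Hom_W A P \<delta> f M N = HomGrp A M N Mod factor_Hom A W M N)"
proof -
  interpret A: abelian_category A by fact
  interpret Aop: abelian_category "opp A" by (rule A.abelian_category_opp)
  have ob: "M \<in> Ob (opp A)" "N \<in> Ob (opp A)"
    using assms by (simp_all add: opp_sel)
  show ?thesis
  proof (intro conjI allI impI)
    show "\<exists>I \<delta> d. proper_coresolution A V M I \<delta> d"
      using A.ex_proper_coresolution[of V M] A.special_preenveloping_mono_preenvelope assms by blast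
    show "\<exists>P \<delta> f. proper_resolution A W N P \<delta> f"
      using Aop.ex_proper_coresolution[OF _ ob(2), of W] A.special_precovering_mono_preenvelope_opp assms
      unfolding opp_sel proper_coresolution_opp[OF assms(1)] by blast
    \<comment> \<open>In \<open>opp A\<close> the objects change places: \<open>N\<close> is
      coresolved, and morphisms go from \<open>N\<close> to \<open>M\<close>.\<close>
    show "stable_Hom_W A P \<delta> f M N = HomGrp A M N Mod factor_Hom A W M N"
      if "proper_resolution A W N P \<delta> f" for P \<delta> f
      using Aop.stable_Hom_V_eq[of W N P \<delta> f M] that ob
      by (simp add: proper_coresolution_opp[OF assms(1)] stable_Hom_V_opp factor_Hom_opp HomGrp_opp)
  \<comment> \<open>Both subgroup claims are instances of one lemma, since factoring through a class
    of objects is self-dual.\<close>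
  qed (use assms A.subgroup_factor_Hom A.stable_Hom_V_eq in blast)+
qed

end
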